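(* Let $G\cong \mathbb{Z}^{(k)}\oplus \mathbb{Z}_{n_1}\oplus\cdots\oplus \mathbb{Z}_{n_t}$ be a finitely generated abelian group, where $n_{i+1}\mid n_i$ for all $1\leq i \leq t-1$. Then the following are equivalent: (i) $G$ is capable. (ii) $G$ is $\mathfrak{N}_c$-capable for some $c\geq 1$. (iii) $G$ is $\mathfrak{N}_c$-capable for all $c\geq 1$. (iv) $G$ is $[\mathfrak{N}_{c_1},\mathfrak{N}_{c_2}]$-capable for all $c_1,c_2$ with $c_2<c_1\leq 2c_2$ or $c_1=c_2>1$. (v) $k\geq 2$, or $k=0$, $t\geq 2$, and $n_1=n_2$.
   Context: $\mathbb{Z}_n$ is the cyclic group of order $n$ and $\mathbb{Z}^{(k)}$ is the direct sum of $k$ copies of $\mathbb{Z}$; $c,c_1,c_2$ denote positive integers. A group $G$ is capable if $G\cong E/Z(E)$ for some group $E$, where $Z(E)$ is the center of $E$. For a set of words $V$ defining a variety $\mathfrak V$ and a group $E$, the marginal subgroup $V^*(E)$ is the set of all $a\in E$ such that $v(g_1,\dots,g_{i-1},g_ia,g_{i+1},\dots,g_n)=v(g_1,\dots,g_n)$ for all $v\in V$, all $g_1,\dots,g_n\in E$ and all $1\le i\le n$. A group $G$ is $\mathfrak V$-capable if there is a group $E$ with $G\cong E/V^*(E)$. $\mathfrak{N}_c$ is the variety of nilpotent groups of class at most $c$, defined by the word $[x_1,\dots,x_{c+1}]$ (left-normed). $[\mathfrak{N}_{c_1},\mathfrak{N}_{c_2}]$ is the outer commutator variety defined by the single word $[[x_1,\dots,x_{c_1+1}],[y_1,\dots,y_{c_2+1}]]$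 in distinct variables, i.e. the variety of groups $G$ with $[\gamma_{c_1+1}(G),\gamma_{c_2+1}(G)]=1$, where $\gamma_n(G)$ is the $n$-th term of the lower central series.
   Formalization: G is additionally assumed nontrivial: the trivial group written with k = 0 and t = 0 (or t = 1, n_1 = 1) satisfies (i)–(iv) but not (v). *)

theory Defs
  imports "HOL-Algebra.Algebra"
begin

section \<open>Group words and their values\<close>

text \<open>
  Words are represented by group terms. Two terms that denote the same element of the free group
  have the same values in every group, and only these values matter below.
\<close>

datatype (word_vars: 'x) group_word =
    Var 'x
  | One
  | Inv "'x group_word"
  | Mult "'x group_word" "'x group_word"

primrec word_value :: "('a, 'm) monoid_scheme \<Rightarrow> ('x \<Rightarrow> 'a) \<Rightarrow> 'x group_word \<Rightarrow> 'a" where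
  "word_value E g (Var x) = g x"
| "word_value E g One = \<one>\<^bsub>E\<^esub>"
| "word_value E g (Inv u) = inv\<^bsub>E\<^esub> (word_value E g u)"
| "word_value E g (Mult u v) = word_value E g u \<otimes>\<^bsub>E\<^esub> word_value E g v"

text \<open>Convention: \<open>[u, v] = u\<^sup>-\<^sup>1 v\<^sup>-\<^sup>1 u v\<close>.\<close>

definition comm_word :: "'x group_word \<Rightarrow> 'x group_word \<Rightarrow> 'x group_word" where
  "comm_word u v = Mult (Mult (Inv u) (Inv v)) (Mult u v)"

text \<open>
  \<open>left_normed_word s n\<close> is \<open>[x\<^sub>s, x\<^sub>s\<^sub>+\<^sub>1, \<dots>, x\<^sub>s\<^sub>+\<^sub>n]\<close>, a left-normed commutator
  of weight \<open>n + 1\<close>.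
\<close>

primrec left_normed_word :: "nat \<Rightarrow> nat \<Rightarrow> nat group_word" where
  "left_normed_word s 0 = Var s"
| "left_normed_word s (Suc n) = comm_word (left_normed_word s n) (Var (s + Suc n))"

definition nilpotent_words :: "nat \<Rightarrow> nat group_word set" where
  "nilpotent_words c = {left_normed_word 0 c}"

text \<open>The second factor uses variables with indices above \<open>c1\<close>, so all variables are distinct.\<close>

definition outer_commutator_words :: "nat \<Rightarrow> nat \<Rightarrow> nat group_word set" where
  "outer_commutator_words c1 c2 =
     {comm_word (left_normed_word 0 c1) (left_normed_word (c1 + 1) c2)}"


section \<open>Capability\<close>

definition center :: "('a, 'm) monoid_scheme \<Rightarrow> 'a set" where
  "center E = {z \<in> carrier E. \<forall>g \<in> carrier E. z \<otimes>\<^bsub>E\<^esub> g = g \<otimes>\<^bsub>E\<^esub> z}"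

text \<open>
  An \<open>n\<close>-tuple of elements substituted for the variables is represented by a total assignment;
  its values at variables not occurring in the word are irrelevant.
\<close>

definition marginal :: "'x group_word set \<Rightarrow> ('a, 'm) monoid_scheme \<Rightarrow> 'a set" where
  "marginal V E = {a \<in> carrier E.
     \<forall>v \<in> V. \<forall>g. (\<forall>x. g x \<in> carrier E) \<longrightarrow>
       (\<forall>i \<in> word_vars v. word_value E (g(i := g i \<otimes>\<^bsub>E\<^esub> a)) v = word_value E g v)}"

text \<open>
  HOL cannot quantify existentially over the type of the elements of \<open>E\<close>, so this type is an
  explicit parameter. Existence of \<open>E\<close> in the usual sense is existence for some parameter type.
  A statement asserted for all infinite parameter types, chosen separately at each occurrence,
  covers all groups \<open>E\<close>, because every finite group also has a copy in each infinite type.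
\<close>

definition capable :: "'e itself \<Rightarrow> ('a, 'm) monoid_scheme \<Rightarrow> bool" where
  "capable (_ :: 'e itself) G \<longleftrightarrow> (\<exists>E :: 'e monoid. group E \<and> G \<cong> E Mod (center E))"

definition varietal_capable ::
    "'e itself \<Rightarrow> 'x group_word set \<Rightarrow> ('a, 'm) monoid_scheme \<Rightarrow> bool" where
  "varietal_capable (_ :: 'e itself) V G \<longleftrightarrow>
     (\<exists>E :: 'e monoid. group E \<and> G \<cong> E Mod (marginal V E))"

end

theory Submission
  imports Defs
begin

text \<open>
  Let \<open>w\<close> be an outer commutator word and suppose that \<open>E / V\<^sup>*(E)\<close> is abelian. Then \<open>w\<close> induces a
  multilinear map on \<open>E / V\<^sup>*(E)\<close>, which is alternating in the two variables of an innermost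
  commutator. If condition (v) fails, then \<open>N G\<close> is a nonzero cyclic group for some \<open>N\<close>; such
  a map vanishes as soon as one argument lies in \<open>N G\<close>, so \<open>N G\<close> would be trivial in
  \<open>E / V\<^sup>*(E)\<close>. This gives the necessity of (v) for all the varieties at once.

  Conversely, let \<open>E\<close> be the group of power series with constant term \<open>1\<close> in noncommuting letters,
  one for each cyclic factor of \<open>G\<close>, where the coefficient of a word is read modulo the common
  divisor of the orders of its letters, and words longer than \<open>w\<close> are ignored. A value of \<open>w\<close> is
  then \<open>1\<close> plus the corresponding Lie commutator of the linear parts, so the marginal subgroup contains all
  series with trivial linear part, and (v) makes it equal to this set: every letter \<open>l\<close> has
  a partner \<open>j\<close> of an order divisible by that of \<open>l\<close>, and a suitable word in \<open>l\<close> and \<open>j\<close> detects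
  the coefficient of \<open>l\<close>.
\<close>

section \<open>Word values and marginal subgroups\<close>

lemma word_value_closed:
  assumes "group E" "\<forall>x. g x \<in> carrier E"
  shows "word_value E g w \<in> carrier E"
proof -
  interpret group E by fact
  show ?thesis using assms(2) by (induction w) auto
qed

lemma word_value_cong:
  assumes "\<forall>x\<in>word_vars w. g x = h x"
  shows "word_value E g w = word_value E h w"
  using assms by (induction w) auto

lemma word_value_hom:
  assumes "group_hom E F f" "\<forall>x. g x \<in> carrier E"
  shows "word_value F (\<lambda>x. f (g x)) w = f (word_value E g w)"
proof -
  interpret group_hom E F f by fact
  show ?thesis
    using assms(2) by (induction w) (auto simp: word_value_closed is_group)
qed

lemma word_value_comm_word:
  "word_value E g (comm_word u v) =
     (inv\<^bsub>E\<^esub> (word_value E g u) \<otimes>\<^bsub>E\<^esub> inv\<^bsub>E\<^esub> (word_value E g v)) \<otimes>\<^bsub>E\<^esub>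
     (word_value E g u \<otimes>\<^bsub>E\<^esub> word_value E g v)"
  by (simp add: comm_word_def)

lemma word_vars_comm_word [simp]: "word_vars (comm_word u v) = word_vars u \<union> word_vars v"
  by (auto simp: comm_word_def)

lemma finite_word_vars: "finite (word_vars w)"
  by (induction w) auto

lemma (in group) r_inv_cancel: "x \<in> carrier G \<Longrightarrow> z \<in> carrier G \<Longrightarrow> x \<otimes> (inv x \<otimes> z) = z"
  by (simp flip: m_assoc)

lemma (in group) l_inv_cancel: "x \<in> carrier G \<Longrightarrow> z \<in> carrier G \<Longrightarrow> inv x \<otimes> (x \<otimes> z) = z"
  by (simp flip: m_assoc)

lemma (in group) conj_hom: "y \<in> carrier G \<Longrightarrow> group_hom G G (\<lambda>x. inv y \<otimes> x \<otimes> y)"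
  by (intro group_hom.intro group_hom_axioms.intro is_group homI)
     (simp_all add: m_assoc r_inv_cancel)

lemma (in group) word_value_conj:
  assumes "\<forall>x. g x \<in> carrier G" "y \<in> carrier G"
  shows "word_value G (\<lambda>x. inv y \<otimes> g x \<otimes> y) w = inv y \<otimes> word_value G g w \<otimes> y"
  using word_value_hom[OF conj_hom] assms by blast

section \<open>Marginal subgroups and their quotients\<close>

lemma marginalD:
  assumes "a \<in> marginal V E" "v \<in> V" "\<forall>x. g x \<in> carrier E" "i \<in> word_vars v"
  shows "word_value E (g(i := g i \<otimes>\<^bsub>E\<^esub> a)) v = word_value E g v"
  using assms unfolding marginal_def by blast

lemma marginal_closed: "a \<in> marginal V E \<Longrightarrow> a \<in> carrier E"
  by (auto simp: marginal_def)

lemma (in group) subgroup_marginal: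
  fixes V :: "'x group_word set"
  shows "subgroup (marginal V G) G"
proof (rule subgroupI)
  show "marginal V G \<subseteq> carrier G" by (auto intro: marginal_closed)
  have "\<one> \<in> marginal V G" unfolding marginal_def by (auto simp: fun_upd_idem)
  then show "marginal V G \<noteq> {}" by blast
next
  fix a assume a: "a \<in> marginal V G"
  then have ac: "a \<in> carrier G" by (auto intro: marginal_closed)
  show "inv a \<in> marginal V G"
    unfolding marginal_def
  proof (intro CollectI conjI ballI allI impI)
    fix v i and g :: "'x \<Rightarrow> 'a"
    assume v: "v \<in> V" "\<forall>x. g x \<in> carrier G" "i \<in> word_vars v"
    let ?h = "g(i := g i \<otimes> inv a)"
    have "\<forall>x. ?h x \<in> carrier G" using v ac by simp
    \<comment> \<open>Multiplying the changed entry by \<open>a\<close> restores \<open>g\<close>,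
      so the marginality of \<open>a\<close> is applied at the tuple \<open>?h\<close>.\<close>
    from marginalD[OF a v(1) this v(3)]
    have "word_value G ?h v = word_value G (?h(i := ?h i \<otimes> a)) v" by (rule sym)
    also have "?h(i := ?h i \<otimes> a) = g" using v ac by (auto simp: fun_eq_iff m_assoc)
    finally show "word_value G ?h v = word_value G g v" .
  qed (use ac in simp)
next
  fix a b assume ab: "a \<in> marginal V G" "b \<in> marginal V G"
  then have c: "a \<in> carrier G" "b \<in> carrier G" by (auto intro: marginal_closed)
  show "a \<otimes> b \<in> marginal V G"
    unfolding marginal_def
  proof (intro CollectI conjI ballI allI impI)
    fix v i and g :: "'x \<Rightarrow> 'a"
    assume v: "v \<in> V" "\<forall>x. g x \<in> carrier G" "i \<in> word_vars v"
    let ?h = "g(i := g i \<otimes> a)"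
    have "\<forall>x. ?h x \<in> carrier G" using v c by simp
    from marginalD[OF ab(2) v(1) this v(3)]
    have "word_value G (?h(i := ?h i \<otimes> b)) v = word_value G g v"
      by (rule trans[OF _ marginalD[OF ab(1) v]])
    moreover have "?h(i := ?h i \<otimes> b) = g(i := g i \<otimes> (a \<otimes> b))"
      using v c by (simp add: m_assoc)
    ultimately show "word_value G (g(i := g i \<otimes> (a \<otimes> b))) v = word_value G g v" by metis
  qed (use c in simp)
qed

text \<open>Conjugation by \<open>y\<close> commutes with taking word values and turns a change of
  an entry by \<open>y \<otimes> a \<otimes> inv y\<close> into a change of the conjugated entry by
  \<open>a\<close>.\<close>

lemma (in group) normal_marginal:
  fixes V :: "'x group_word set"
  shows "marginal V G \<lhd> G"
proof (rule normal_invI[OF subgroup_marginal])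
  fix y a assume y: "y \<in> carrier G" and a: "a \<in> marginal V G"
  have ac: "a \<in> carrier G" using a by (rule marginal_closed)
  show "y \<otimes> a \<otimes> inv y \<in> marginal V G"
    unfolding marginal_def
  proof (intro CollectI conjI ballI allI impI)
    fix v i and g :: "'x \<Rightarrow> 'a"
    assume v: "v \<in> V" "\<forall>x. g x \<in> carrier G" "i \<in> word_vars v"
    let ?c = "\<lambda>x. inv y \<otimes> x \<otimes> y"
    let ?h = "g(i := g i \<otimes> (y \<otimes> a \<otimes> inv y))"
    have h: "\<forall>x. ?h x \<in> carrier G" using v ac y by simp
    have eq: "(\<lambda>x. ?c (?h x)) = (\<lambda>x. ?c (g x))(i := ?c (g i) \<otimes> a)"
      using v(2) y ac by (auto simp: fun_eq_iff m_assoc)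
    have "?c (word_value G ?h v) = word_value G (\<lambda>x. ?c (?h x)) v"
      by (rule word_value_conj[OF h y, symmetric])
    also have "\<dots> = word_value G (\<lambda>x. ?c (g x)) v"
      unfolding eq using marginalD[OF a v(1) _ v(3), of "\<lambda>x. ?c (g x)"] v(2) y by simp
    also have "\<dots> = ?c (word_value G g v)"
      using word_value_conj[OF v(2) y] .
    finally show "word_value G ?h v = word_value G g v"
      using word_value_closed[OF is_group h] word_value_closed[OF is_group v(2)] y by simp
  qed (use ac y in simp)
qed

text \<open>Makes capability the case \<open>c = 1\<close> of nilpotent capability. A central factor
  in either entry cancels in \<open>[x, y]\<close>.\<close>

lemma (in group) center_eq_marginal: "center G = marginal (nilpotent_words 1) G"
proof -
  have wv: "word_value G g (left_normed_word 0 1) = inv (g 0) \<otimes> inv (g 1) \<otimes> (g 0 \<otimes> g 1)" for g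
    by (simp add: word_value_comm_word)
  have vars: "word_vars (left_normed_word 0 1) = {0, 1}" by auto
  show ?thesis
  proof (intro subset_antisym subsetI)
    fix a assume a: "a \<in> center G"
    then have ac: "a \<in> carrier G" and com: "\<And>g. g \<in> carrier G \<Longrightarrow> a \<otimes> g = g \<otimes> a"
      by (auto simp: center_def)
    have icom: "\<And>g. g \<in> carrier G \<Longrightarrow> inv a \<otimes> g = g \<otimes> inv a"
      using ac com by (metis inv_closed inv_solve_left' inv_solve_right m_assoc m_closed)
    have 1: "inv (x \<otimes> a) \<otimes> inv y \<otimes> (x \<otimes> a \<otimes> y) = inv x \<otimes> inv y \<otimes> (x \<otimes> y)"
      if "x \<in> carrier G" "y \<in> carrier G" for x y
    proof -
      have "inv (x \<otimes> a) \<otimes> inv y \<otimes> (x \<otimes> a \<otimes> y) = inv a \<otimes> (inv x \<otimes> inv y \<otimes> (x \<otimes> (a \<otimes> y)))"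
        using that ac by (simp add: inv_mult_group m_assoc)
      also have "\<dots> = inv a \<otimes> ((inv x \<otimes> inv y \<otimes> (x \<otimes> y)) \<otimes> a)"
        using that ac by (simp add: com m_assoc)
      also have "\<dots> = inv x \<otimes> inv y \<otimes> (x \<otimes> y)"
        using that ac by (subst com[symmetric]) (simp_all flip: m_assoc)
      finally show ?thesis .
    qed
    have 2: "inv x \<otimes> inv (y \<otimes> a) \<otimes> (x \<otimes> (y \<otimes> a)) = inv x \<otimes> inv y \<otimes> (x \<otimes> y)"
      if "x \<in> carrier G" "y \<in> carrier G" for x y
    proof -
      have "inv x \<otimes> inv (y \<otimes> a) \<otimes> (x \<otimes> (y \<otimes> a)) = inv x \<otimes> inv a \<otimes> inv y \<otimes> (x \<otimes> y) \<otimes> a"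
        using that ac by (simp add: inv_mult_group m_assoc)
      also have "\<dots> = inv a \<otimes> (inv x \<otimes> inv y \<otimes> (x \<otimes> y)) \<otimes> a"
        using that ac icom[of "inv x"] by (simp flip: m_assoc)
      also have "\<dots> = inv x \<otimes> inv y \<otimes> (x \<otimes> y)"
        using that ac by (subst m_assoc, simp, simp, simp, subst com[symmetric]) (simp_all flip: m_assoc)
      finally show ?thesis .
    qed
    show "a \<in> marginal (nilpotent_words 1) G"
      unfolding marginal_def nilpotent_words_def
    proof (intro CollectI conjI ballI allI impI; (elim singletonE)?)
      fix v :: "nat group_word" and g :: "nat \<Rightarrow> 'a" and i
      assume "v = left_normed_word 0 1" "i \<in> word_vars v" and g: "\<forall>x. g x \<in> carrier G"
      then have v: "v = left_normed_word 0 1" and i: "i = 0 \<or> i = 1" using vars by auto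
      show "word_value G (g(i := g i \<otimes> a)) v = word_value G g v"
        unfolding v wv using i 1 2 g by auto
    qed (rule ac)
  next
    fix a assume a: "a \<in> marginal (nilpotent_words 1) G"
    then have ac: "a \<in> carrier G" by (auto intro: marginal_closed)
    show "a \<in> center G"
      unfolding center_def
    proof (intro CollectI conjI ballI)
      fix y assume y: "y \<in> carrier G"
      \<comment> \<open>At this tuple the value is \<open>[\<one>, y] = \<one>\<close>; marginality
        of \<open>a\<close> then gives \<open>[a, y] = \<one>\<close>.\<close>
      let ?g = "(\<lambda>_. y)(0::nat := \<one>)"
      have "word_value G (?g(0 := ?g 0 \<otimes> a)) (left_normed_word 0 1) =
            word_value G ?g (left_normed_word 0 1)"
        by (rule marginalD[OF a]) (use y vars in \<open>auto simp: nilpotent_words_def\<close>)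
      then have "inv a \<otimes> inv y \<otimes> (a \<otimes> y) = \<one>"
        unfolding wv using y ac by simp
      then have "inv (y \<otimes> a) \<otimes> (a \<otimes> y) = \<one>" using y ac by (simp add: inv_mult_group)
      then show "a \<otimes> y = y \<otimes> a" using y ac
        by (metis inv_closed inv_equality inv_inv inv_mult_group m_closed)
    qed (rule ac)
  qed
qed

lemma capable_iff_nilpotent: "capable TYPE('e) G \<longleftrightarrow> varietal_capable TYPE('e) (nilpotent_words 1) G"
  unfolding capable_def varietal_capable_def using group.center_eq_marginal by metis

text \<open>Replaces the isomorphism with a quotient by a surjection whose kernel is the marginal
  subgroup, so that marginality is read off in \<open>G\<close> and cosets disappear.\<close>

lemma varietal_capable_kernelD:
  assumes "varietal_capable TYPE('e) V G" "group G"
  obtains E :: "'e monoid" and \<psi>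
  where "group E" "group_hom E G \<psi>" "\<psi> ` carrier E = carrier G" "kernel E G \<psi> = marginal V E"
proof -
  from assms(1) obtain E :: "'e monoid" where E: "group E" "G \<cong> E Mod (marginal V E)"
    unfolding varietal_capable_def by blast
  interpret group E by fact
  interpret N: normal "marginal V E" E by (rule normal_marginal)
  from E(2) obtain f where f: "f \<in> iso (E Mod (marginal V E)) G"
    using group.iso_sym[OF assms(2)] is_iso_def by blast
  have fh: "group_hom (E Mod (marginal V E)) G f"
    using f assms(2) N.factorgroup_is_group
    by (simp add: group_hom_def group_hom_axioms_def iso_def)
  define \<psi> where "\<psi> = f \<circ> (#>\<^bsub>E\<^esub>) (marginal V E)"
  have hom: "\<psi> \<in> hom E G"
    unfolding \<psi>_def using N.r_coset_hom_Mod group_hom.homh[OF fh] by (rule Group.hom_compose)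
  have "(#>\<^bsub>E\<^esub>) (marginal V E) ` carrier E = carrier (E Mod (marginal V E))"
    by (auto simp: FactGroup_def RCOSETS_def)
  then have surj: "\<psi> ` carrier E = carrier G"
    unfolding \<psi>_def image_comp[symmetric] using f by (simp add: iso_def bij_betw_def)
  have "\<psi> a = \<one>\<^bsub>G\<^esub> \<longleftrightarrow> a \<in> marginal V E" if a: "a \<in> carrier E" for a
  proof -
    have "marginal V E #>\<^bsub>E\<^esub> a \<in> carrier (E Mod (marginal V E))"
      using a by (auto simp: FactGroup_def RCOSETS_def)
    then have "\<psi> a = \<one>\<^bsub>G\<^esub> \<longleftrightarrow> marginal V E #>\<^bsub>E\<^esub> a = \<one>\<^bsub>E Mod (marginal V E)\<^esub>"
      unfolding \<psi>_def comp_def using f group_hom.hom_one[OF fh] group.is_monoid[OF N.factorgroup_is_group]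
      by (metis (no_types, lifting) bij_betw_def inj_onD iso_def mem_Collect_eq monoid.one_closed)
    also have "\<dots> \<longleftrightarrow> a \<in> marginal V E"
      using a N.is_subgroup coset_join1 coset_join2 rcos_self
      by (metis (no_types, lifting) monoid.simps(2) FactGroup_def)
    finally show ?thesis .
  qed
  then have "kernel E G \<psi> = marginal V E"
    using marginal_closed[of _ V E] by (auto simp: kernel_def)
  with E(1) assms(2) hom surj show ?thesis
    by (intro that) (simp_all add: group_hom_def group_hom_axioms_def)
qed

section \<open>Outer commutator words\<close>

text \<open>Covers both families of words, so each argument is one induction. Disjointness puts
  every variable on only one side of each commutator.\<close>

inductive outer_commutator :: "'x group_word \<Rightarrow> bool" where
  Var: "outer_commutator (Var i)"
| comm: "outer_commutator u \<Longrightarrow> outer_commutator v \<Longrightarrow> word_vars u \<inter> word_vars v = {} \<Longrightarrow>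
    outer_commutator (comm_word u v)"

lemma comm_word_neq_Var [simp]: "comm_word u v \<noteq> Var i"
  by (simp add: comm_word_def)

lemma word_vars_left_normed_word: "word_vars (left_normed_word s c) = {s..s + c}"
  by (induction c) (simp_all add: atLeastAtMostSuc_conv)

lemma outer_commutator_left_normed: "outer_commutator (left_normed_word s c)"
proof (induction c)
  case (Suc c)
  have "word_vars (left_normed_word s c) \<inter> word_vars (Var (s + Suc c)) = {}"
    by (simp add: word_vars_left_normed_word)
  with Suc show ?case
    unfolding left_normed_word.simps by (intro outer_commutator.intros)
qed (simp add: outer_commutator.Var)

text \<open>An innermost commutator \<open>[x\<^sub>i, x\<^sub>j]\<close> makes the word alternating in these two variables.\<close>

lemma outer_commutator_alternating:
  assumes "outer_commutator w" "\<nexists>x. w = Var x"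
  shows "\<exists>i\<in>word_vars w. \<exists>j\<in>word_vars w. i \<noteq> j \<and>
    (\<forall>g. (\<forall>x. g x \<in> carrier E) \<longrightarrow> g i = g j \<longrightarrow> group E \<longrightarrow> word_value E g w = \<one>\<^bsub>E\<^esub>)"
  using assms
proof (induction w rule: outer_commutator.induct)
  case (comm u v)
  have closed: "word_value E g w \<in> carrier E" if "group E" "\<forall>x. g x \<in> carrier E" for g w
    using that by (rule word_value_closed)
  show ?case
  proof (cases "\<exists>x. u = Var x")
    case False
    then obtain i j where ij: "i \<in> word_vars u" "j \<in> word_vars u" "i \<noteq> j"
      "\<And>g. (\<forall>x. g x \<in> carrier E) \<Longrightarrow> g i = g j \<Longrightarrow> group E \<Longrightarrow> word_value E g u = \<one>\<^bsub>E\<^esub>"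
      using comm.IH(1) by blast
    have "word_value E g (comm_word u v) = \<one>\<^bsub>E\<^esub>"
      if g: "\<forall>x. g x \<in> carrier E" "g i = g j" "group E" for g
    proof -
      interpret group E by fact
      show ?thesis using ij(4)[OF g] closed[OF g(3,1)] by (simp add: word_value_comm_word)
    qed
    with ij show ?thesis by auto
  next
    case u: True
    show ?thesis
    proof (cases "\<exists>x. v = Var x")
      case False
      then obtain i j where ij: "i \<in> word_vars v" "j \<in> word_vars v" "i \<noteq> j"
        "\<And>g. (\<forall>x. g x \<in> carrier E) \<Longrightarrow> g i = g j \<Longrightarrow> group E \<Longrightarrow> word_value E g v = \<one>\<^bsub>E\<^esub>"
        using comm.IH(2) by blast
      have "word_value E g (comm_word u v) = \<one>\<^bsub>E\<^esub>"
        if g: "\<forall>x. g x \<in> carrier E" "g i = g j" "group E" for g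
      proof -
        interpret group E by fact
        show ?thesis using ij(4)[OF g] closed[OF g(3,1)] by (simp add: word_value_comm_word)
      qed
      with ij show ?thesis by auto
    next
      case True
      then obtain i j where ij: "u = Var i" "v = Var j" using u by blast
      have "word_value E g (comm_word u v) = \<one>\<^bsub>E\<^esub>"
        if g: "\<forall>x. g x \<in> carrier E" "g i = g j" "group E" for g
      proof -
        interpret group E by fact
        show ?thesis using g(1,2) unfolding ij by (simp add: word_value_comm_word inv_mult_group[symmetric])
      qed
      moreover have "i \<noteq> j" using comm.hyps ij by auto
      ultimately show ?thesis using ij by auto
    qed
  qed
qed auto

text \<open>
  Splitting a product in one variable costs only conjugations of the entries, by
  \<open>[ab, d] = [a, d]\<^sup>b [b, d]\<close> and \<open>[a, bd] = [a, d] [a, b]\<^sup>d\<close>.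
\<close>

lemma (in group) outer_commutator_split:
  assumes "outer_commutator w" "i \<in> word_vars w" "\<forall>x. g x \<in> carrier G"
    "a \<in> carrier G" "b \<in> carrier G"
  shows "\<exists>h. (\<forall>x. \<exists>y\<in>carrier G. h x = inv y \<otimes> (g(i := a)) x \<otimes> y) \<and>
    word_value G (g(i := a \<otimes> b)) w = word_value G h w \<otimes> word_value G (g(i := b)) w"
  using assms
proof (induction w rule: outer_commutator.induct)
  case (Var j)
  have "\<forall>x. \<exists>y\<in>carrier G. (g(i := a)) x = inv y \<otimes> (g(i := a)) x \<otimes> y"
    using Var by (auto intro!: bexI[of _ \<one>])
  with Var show ?case by (intro exI[of _ "g(i := a)"]) simp
next
  case (comm u v)
  let ?W = "word_value G"
  have gb: "\<forall>x. (g(i := b)) x \<in> carrier G"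
    and ga: "\<forall>x. (g(i := a)) x \<in> carrier G"
    using comm.prems by auto
  have conj_closed: "\<forall>x. h x \<in> carrier G"
    if hyp: "\<forall>x. \<exists>y\<in>carrier G. h x = inv y \<otimes> (g(i := a)) x \<otimes> y" for h
  proof
    fix x
    obtain y where "y \<in> carrier G" "h x = inv y \<otimes> (g(i := a)) x \<otimes> y"
      using spec[OF hyp, of x] by meson
    moreover have "(g(i := a)) x \<in> carrier G" using ga by blast
    ultimately show "h x \<in> carrier G" by (simp del: fun_upd_apply)
  qed
  have conj_conj: "\<exists>y\<in>carrier G. inv z \<otimes> h x \<otimes> z = inv y \<otimes> (g(i := a)) x \<otimes> y"
    if hyp: "\<forall>x. \<exists>y\<in>carrier G. h x = inv y \<otimes> (g(i := a)) x \<otimes> y" and z: "z \<in> carrier G" for h x z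
  proof -
    obtain y where y: "y \<in> carrier G" "h x = inv y \<otimes> (g(i := a)) x \<otimes> y"
      using spec[OF hyp, of x] by meson
    have "(g(i := a)) x \<in> carrier G" using ga by blast
    with y z show ?thesis
      by (intro bexI[of _ "y \<otimes> z"]) (simp_all add: inv_mult_group m_assoc del: fun_upd_apply)
  qed
  consider "i \<in> word_vars u" "i \<notin> word_vars v" | "i \<in> word_vars v" "i \<notin> word_vars u"
    using comm.prems(1) comm.hyps(3) by auto
  then show ?case
  proof cases
    case 1
    from comm.IH(1)[OF 1(1)] comm.prems obtain h where
      h: "\<forall>x. \<exists>y\<in>carrier G. h x = inv y \<otimes> (g(i := a)) x \<otimes> y" and
      eq: "?W (g(i := a \<otimes> b)) u = ?W h u \<otimes> ?W (g(i := b)) u" by blast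
    \<comment> \<open>\<open>k\<close> agrees with \<open>h\<close> on the variables of
      \<open>u\<close> and with \<open>g\<close> on those of \<open>v\<close>, so a single tuple
      serves both sides of the commutator.\<close>
    define k where "k = (\<lambda>x. if x \<in> word_vars u then h x else (g(i := a)) x)"
    have k: "\<forall>x. \<exists>y\<in>carrier G. k x = inv y \<otimes> (g(i := a)) x \<otimes> y"
    proof
      fix x
      have "(g(i := a)) x \<in> carrier G" using ga by blast
      then show "\<exists>y\<in>carrier G. k x = inv y \<otimes> (g(i := a)) x \<otimes> y"
        using h unfolding k_def by (cases "x \<in> word_vars u") (auto intro!: bexI[of _ \<one>])
    qed
    have hc: "\<forall>x. h x \<in> carrier G" and kc: "\<forall>x. k x \<in> carrier G"
      using conj_closed h k by blast+
    let ?B = "?W (g(i := b)) u"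
    have B: "?B \<in> carrier G" by (rule word_value_closed[OF is_group gb])
    have ku: "?W k u = ?W h u" by (rule word_value_cong) (simp add: k_def)
    have kv: "?W k v = ?W g v"
      by (rule word_value_cong) (use 1 comm.hyps(3) in \<open>auto simp: k_def\<close>)
    have vb: "?W (g(i := c)) v = ?W g v" for c
      by (rule word_value_cong) (use 1 in auto)
    have cl: "?W h u \<in> carrier G" "?W g v \<in> carrier G"
      using word_value_closed[OF is_group] hc comm.prems by blast+
    have "?W (g(i := a \<otimes> b)) (comm_word u v) =
        inv ?B \<otimes> ?W k (comm_word u v) \<otimes> ?B \<otimes> ?W (g(i := b)) (comm_word u v)"
      unfolding word_value_comm_word eq ku kv vb using cl B
      by (simp add: inv_mult_group m_assoc r_inv_cancel l_inv_cancel)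
    also have "inv ?B \<otimes> ?W k (comm_word u v) \<otimes> ?B = ?W (\<lambda>x. inv ?B \<otimes> k x \<otimes> ?B) (comm_word u v)"
      using word_value_conj[OF kc B] by simp
    finally show ?thesis
      by (intro exI[of _ "\<lambda>x. inv ?B \<otimes> k x \<otimes> ?B"] conjI allI conj_conj[OF k B])
  next
    case 2
    from comm.IH(2)[OF 2(1)] comm.prems obtain h where
      h: "\<forall>x. \<exists>y\<in>carrier G. h x = inv y \<otimes> (g(i := a)) x \<otimes> y" and
      eq: "?W (g(i := a \<otimes> b)) v = ?W h v \<otimes> ?W (g(i := b)) v" by blast
    define k where "k = (\<lambda>x. if x \<in> word_vars v then h x else (g(i := a)) x)"
    have k: "\<forall>x. \<exists>y\<in>carrier G. k x = inv y \<otimes> (g(i := a)) x \<otimes> y"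
    proof
      fix x
      have "(g(i := a)) x \<in> carrier G" using ga by blast
      then show "\<exists>y\<in>carrier G. k x = inv y \<otimes> (g(i := a)) x \<otimes> y"
        using h unfolding k_def by (cases "x \<in> word_vars v") (auto intro!: bexI[of _ \<one>])
    qed
    have hc: "\<forall>x. h x \<in> carrier G" and kc: "\<forall>x. k x \<in> carrier G"
      using conj_closed h k by blast+
    \<comment> \<open>For the value \<open>D\<close> of \<open>u\<close> and the values
      \<open>A\<close>, \<open>B\<close> of \<open>v\<close>, the expansion is
      \<open>[D, B] [D, A]^B\<close>, with the factors in the wrong order. Conjugating further by
      the inverse of \<open>[D, B]\<close> moves that factor to the right.\<close>
    let ?B = "?W (g(i := b)) v \<otimes> inv (?W (g(i := b)) (comm_word u v))"
    have B: "?B \<in> carrier G"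
      using word_value_closed[OF is_group gb] by blast
    have kv: "?W k v = ?W h v" by (rule word_value_cong) (simp add: k_def)
    have ku: "?W k u = ?W g u"
      by (rule word_value_cong) (use 2 comm.hyps(3) in \<open>auto simp: k_def\<close>)
    have ub: "?W (g(i := c)) u = ?W g u" for c
      by (rule word_value_cong) (use 2 in auto)
    have cl: "?W h v \<in> carrier G" "?W g u \<in> carrier G" "?W (g(i := b)) v \<in> carrier G"
      using word_value_closed[OF is_group] hc gb comm.prems by blast+
    have "?W (g(i := a \<otimes> b)) (comm_word u v) =
        inv ?B \<otimes> ?W k (comm_word u v) \<otimes> ?B \<otimes> ?W (g(i := b)) (comm_word u v)"
      unfolding word_value_comm_word eq ku kv ub using cl
      by (simp add: inv_mult_group m_assoc r_inv_cancel l_inv_cancel)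
    also have "inv ?B \<otimes> ?W k (comm_word u v) \<otimes> ?B = ?W (\<lambda>x. inv ?B \<otimes> k x \<otimes> ?B) (comm_word u v)"
      using word_value_conj[OF kc B] by simp
    finally show ?thesis
      by (intro exI[of _ "\<lambda>x. inv ?B \<otimes> k x \<otimes> ?B"] conjI allI conj_conj[OF k B])
  qed
qed

text \<open>
  If \<open>E\<close> is abelian modulo the marginal subgroup of an outer commutator word, the conjugations in
  \<open>outer_commutator_split\<close> do not matter, and the word is multiplicative in every variable.
\<close>

locale abelian_marginal_quotient = group E for E (structure) +
  fixes w :: "'x group_word"
  assumes outer: "outer_commutator w"
    and comm_marginal: "\<And>a b. a \<in> carrier E \<Longrightarrow> b \<in> carrier E \<Longrightarrow>
      inv a \<otimes> inv b \<otimes> a \<otimes> b \<in> marginal {w} E"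
begin

abbreviation W where "W g \<equiv> word_value E g w"

lemma W_closed: "\<forall>x. g x \<in> carrier E \<Longrightarrow> W g \<in> carrier E"
  by (rule word_value_closed[OF is_group])

lemma W_upd_marginal:
  assumes "\<forall>x. g x \<in> carrier E" "b \<in> carrier E" "a \<in> marginal {w} E" "i \<in> word_vars w"
  shows "W (g(i := b \<otimes> a)) = W (g(i := b))"
  using marginalD[OF assms(3), of w "g(i := b)" i] assms by simp

text \<open>The entries are changed one variable at a time; finitely many changes suffice because
  only the variables of \<open>w\<close> affect the value.\<close>

lemma W_cong_marginal:
  assumes g: "\<forall>x. g x \<in> carrier E"
    and h: "\<forall>x. \<exists>a\<in>marginal {w} E. h x = g x \<otimes> a"
  shows "W h = W g"
proof -
  have hc: "\<forall>x. h x \<in> carrier E"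
    using g h by (metis m_closed marginal_closed)
  have "W (\<lambda>x. if x \<in> S then h x else g x) = W g" if "finite S" "S \<subseteq> word_vars w" for S
    using that
  proof (induction S rule: finite_induct)
    case (insert i S)
    let ?f = "\<lambda>x. if x \<in> S then h x else g x"
    obtain a where a: "a \<in> marginal {w} E" "h i = g i \<otimes> a" using h by blast
    have "(\<lambda>x. if x \<in> insert i S then h x else g x) = ?f(i := g i \<otimes> a)"
      using a by (auto simp: fun_eq_iff)
    then have "W (\<lambda>x. if x \<in> insert i S then h x else g x) = W (?f(i := g i \<otimes> a))" by simp
    also have "\<dots> = W (?f(i := g i))"
      by (rule W_upd_marginal) (use a g hc insert in auto)
    also have "?f(i := g i) = ?f" using insert by (auto simp: fun_eq_iff)
    finally show ?case using insert by simp
  qed simp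
  from this[OF finite_word_vars order_refl]
  have "W (\<lambda>x. if x \<in> word_vars w then h x else g x) = W g" .
  moreover have "W (\<lambda>x. if x \<in> word_vars w then h x else g x) = W h"
    by (rule word_value_cong) simp
  ultimately show ?thesis by simp
qed

text \<open>The conjugate of \<open>z\<close> by \<open>y\<close> is \<open>z [z, y]\<close> with a
  marginal commutator, so the conjugations produced by \<open>outer_commutator_split\<close> can be
  undone.\<close>

lemma W_mult:
  assumes g: "\<forall>x. g x \<in> carrier E" and i: "i \<in> word_vars w"
    and ab: "a \<in> carrier E" "b \<in> carrier E"
  shows "W (g(i := a \<otimes> b)) = W (g(i := a)) \<otimes> W (g(i := b))"
proof -
  obtain h where h: "\<forall>x. \<exists>y\<in>carrier E. h x = inv y \<otimes> (g(i := a)) x \<otimes> y"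
    and eq: "W (g(i := a \<otimes> b)) = W h \<otimes> W (g(i := b))"
    using outer_commutator_split[OF outer i g ab] by blast
  have ga: "\<forall>x. (g(i := a)) x \<in> carrier E" using g ab by simp
  have "\<exists>c\<in>marginal {w} E. h x = (g(i := a)) x \<otimes> c" for x
  proof -
    obtain y where y: "y \<in> carrier E" "h x = inv y \<otimes> (g(i := a)) x \<otimes> y" using h by blast
    have gx: "(g(i := a)) x \<in> carrier E" using ga by blast
    show ?thesis
      by (rule bexI[OF _ comm_marginal[OF gx y(1)]])
         (use y gx in \<open>simp add: m_assoc r_inv_cancel del: fun_upd_apply\<close>)
  qed
  then have "W h = W (g(i := a))" using W_cong_marginal[OF ga] by blast
  with eq show ?thesis by simp
qed

lemma W_hom:
  assumes "\<forall>x. g x \<in> carrier E" "i \<in> word_vars w"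
  shows "group_hom E E (\<lambda>a. W (g(i := a)))"
  using assms W_mult W_closed
  by (intro group_hom.intro group_hom_axioms.intro is_group homI) auto

lemmas W_pow = group_hom.hom_nat_pow[OF W_hom] and W_int_pow = group_hom.hom_int_pow[OF W_hom]

text \<open>Modulo the marginal subgroup all \<open>n\<close>-th powers are powers of that of
  \<open>x\<close>. Hence the \<open>n\<close>-th power of a value of \<open>w\<close> is a power of
  the \<open>n\<close>-th power of the value with \<open>x\<close> put in any one place. Putting
  \<open>x\<close> in both alternating places makes it trivial, so by multiplicativity the factor
  \<open>x [^] n\<close> changes no value.\<close>

lemma pow_in_marginal:
  assumes x: "x \<in> carrier E" and nv: "\<nexists>y. w = Var y"
    and cyc: "\<And>g. g \<in> carrier E \<Longrightarrow> \<exists>m::int. \<exists>a\<in>marginal {w} E. g [^] (n::nat) = (x [^] n) [^] m \<otimes> a"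
  shows "x [^] n \<in> marginal {w} E"
proof -
  obtain i j where ij: "i \<in> word_vars w" "j \<in> word_vars w" "i \<noteq> j"
    and alt: "\<And>g. \<forall>x. g x \<in> carrier E \<Longrightarrow> g i = g j \<Longrightarrow> W g = \<one>"
    using outer_commutator_alternating[OF outer nv, of E] is_group by blast
  have pow_upd: "\<exists>m::int. W (g(l := b)) [^] n = (W (g(l := x)) [^] n) [^] m"
    if g: "\<forall>x. g x \<in> carrier E" and l: "l \<in> word_vars w" and b: "b \<in> carrier E" for g l b
  proof -
    obtain m :: int and a where a: "a \<in> marginal {w} E" "b [^] n = (x [^] n) [^] m \<otimes> a"
      using cyc[OF b] by blast
    have "W (g(l := b)) [^] n = W (g(l := b [^] n))" using W_pow[OF g l b] by simp
    also have "\<dots> = W (g(l := (x [^] n) [^] m))"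
      unfolding a(2) by (rule W_upd_marginal) (use g l a x in auto)
    also have "\<dots> = (W (g(l := x)) [^] n) [^] m"
      using W_int_pow[OF g l, of "x [^] n" m] W_pow[OF g l x, of n] x by simp
    finally show ?thesis by blast
  qed
  \<comment> \<open>With \<open>x\<close> already at \<open>i\<close>, the entry at \<open>j\<close>
    is exchanged for \<open>x\<close> as well, and the word alternates in these two places.\<close>
  have first: "W (g(i := x)) [^] n = \<one>" if g: "\<forall>x. g x \<in> carrier E" for g
  proof -
    let ?g = "g(i := x)"
    have gx: "\<forall>y. ?g y \<in> carrier E" using g x by simp
    obtain m :: int where "W (?g(j := g j)) [^] n = (W (?g(j := x)) [^] n) [^] m"
      using pow_upd[OF gx ij(2)] g by blast
    moreover have "W (?g(j := x)) = \<one>"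
      by (rule alt) (use gx x ij in auto)
    moreover have "?g(j := g j) = ?g" using ij by (auto simp: fun_eq_iff)
    ultimately show ?thesis by (metis int_pow_one nat_pow_one)
  qed
  \<comment> \<open>Exchanging the entry at \<open>i\<close> for \<open>x\<close> reduces this to
    \<open>first\<close>.\<close>
  have any: "W (g(l := x)) [^] n = \<one>" if g: "\<forall>x. g x \<in> carrier E" and l: "l \<in> word_vars w" for g l
  proof -
    let ?h = "g(l := x)"
    have h: "\<forall>y. ?h y \<in> carrier E" using g x by simp
    obtain m :: int where "W (?h(i := ?h i)) [^] n = (W (?h(i := x)) [^] n) [^] m"
      using pow_upd[OF h ij(1)] h by blast
    moreover have "?h(i := ?h i) = ?h" by (rule fun_upd_triv)
    ultimately show ?thesis using first[OF h] by (metis int_pow_one)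
  qed
  show ?thesis
    unfolding marginal_def
  proof (intro CollectI conjI ballI allI impI; (elim singletonE)?)
    fix v i and g :: "'x \<Rightarrow> 'a" assume v: "v = w" and g: "\<forall>x. g x \<in> carrier E" and "i \<in> word_vars v"
    then have i: "i \<in> word_vars w" by simp
    have "W (g(i := g i \<otimes> x [^] n)) = W (g(i := g i)) \<otimes> W (g(i := x [^] n))"
      by (rule W_mult) (use g i x in auto)
    also have "\<dots> = W g" using W_pow[OF g i x, of n] any[OF g i] W_closed[OF g] by simp
    finally show "word_value E (g(i := g i \<otimes> x [^] n)) v = word_value E g v" unfolding v .
  qed (use x in simp)
qed

end

text \<open>By hypothesis the \<open>n\<close>-th powers in \<open>G\<close> form a nontrivial
  cyclic group generated by that of \<open>e\<close>. For a preimage \<open>x\<close> of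
  \<open>e\<close>, the power \<open>x [^] n\<close> would be marginal, hence in the kernel, and the
  \<open>n\<close>-th power of \<open>e\<close> would be trivial.\<close>

theorem not_varietal_capable:
  assumes G: "comm_group G" and w: "outer_commutator w" "\<nexists>y. w = Var y"
    and e: "e \<in> carrier G" "e [^]\<^bsub>G\<^esub> (n::nat) \<noteq> \<one>\<^bsub>G\<^esub>"
    and cyc: "\<And>g. g \<in> carrier G \<Longrightarrow> \<exists>m::int. g [^]\<^bsub>G\<^esub> n = (e [^]\<^bsub>G\<^esub> n) [^]\<^bsub>G\<^esub> m"
  shows "\<not> varietal_capable TYPE('e) {w} G"
proof
  interpret A: comm_group G by fact
  assume "varietal_capable TYPE('e) {w} G"
  then obtain E :: "'e monoid" and \<psi> where E: "group E" and hom: "group_hom E G \<psi>"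
    and surj: "\<psi> ` carrier E = carrier G" and ker: "kernel E G \<psi> = marginal {w} E"
    using varietal_capable_kernelD[OF _ A.is_group] by blast
  interpret group_hom E G \<psi> by fact
  have kerI: "a \<in> marginal {w} E" if "a \<in> carrier E" "\<psi> a = \<one>\<^bsub>G\<^esub>" for a
    using that unfolding ker[symmetric] kernel_def by simp
  interpret abelian_marginal_quotient E w
  proof (unfold_locales, rule w(1), rule kerI)
    fix a b assume ab: "a \<in> carrier E" "b \<in> carrier E"
    then have "\<psi> a \<otimes>\<^bsub>G\<^esub> \<psi> b = \<psi> b \<otimes>\<^bsub>G\<^esub> \<psi> a" by (intro A.m_comm) auto
    with ab show "\<psi> (inv\<^bsub>E\<^esub> a \<otimes>\<^bsub>E\<^esub> inv\<^bsub>E\<^esub> b \<otimes>\<^bsub>E\<^esub> a \<otimes>\<^bsub>E\<^esub> b) = \<one>\<^bsub>G\<^esub>"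
      by (simp add: A.m_assoc A.r_inv_cancel A.l_inv_cancel)
  qed simp
  obtain x where x: "x \<in> carrier E" "\<psi> x = e" using surj e(1) by (metis imageE)
  have "x [^]\<^bsub>E\<^esub> n \<in> marginal {w} E"
  proof (rule pow_in_marginal[OF x(1) w(2)])
    fix g assume g: "g \<in> carrier E"
    obtain m :: int where m: "\<psi> g [^]\<^bsub>G\<^esub> n = (e [^]\<^bsub>G\<^esub> n) [^]\<^bsub>G\<^esub> m" using cyc[of "\<psi> g"] g by auto
    let ?y = "(x [^]\<^bsub>E\<^esub> n) [^]\<^bsub>E\<^esub> m"
    \<comment> \<open>The relation between \<open>n\<close>-th powers lifts from \<open>G\<close> to
      \<open>E\<close> only up to this factor, which lies in the kernel and is therefore
      marginal.\<close>
    let ?a = "inv\<^bsub>E\<^esub> ?y \<otimes>\<^bsub>E\<^esub> g [^]\<^bsub>E\<^esub> n"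
    have yc: "?y \<in> carrier E" using x by simp
    have "\<psi> ?y = \<psi> (g [^]\<^bsub>E\<^esub> n)" using g x m by (simp add: hom_nat_pow hom_int_pow)
    then have "?a \<in> marginal {w} E" using g yc by (intro kerI) simp_all
    moreover have "g [^]\<^bsub>E\<^esub> n = ?y \<otimes>\<^bsub>E\<^esub> ?a" using g yc by (simp add: r_inv_cancel)
    ultimately show "\<exists>m::int. \<exists>a\<in>marginal {w} E. g [^]\<^bsub>E\<^esub> n = (x [^]\<^bsub>E\<^esub> n) [^]\<^bsub>E\<^esub> m \<otimes>\<^bsub>E\<^esub> a"
      by blast
  qed
  then have "\<psi> x [^]\<^bsub>G\<^esub> n = \<one>\<^bsub>G\<^esub>"
    using x unfolding ker[symmetric] kernel_def by (simp add: hom_nat_pow)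
  with e x show False by simp
qed

section \<open>Noncommutative power series\<close>

text \<open>A type of its own around the coefficient function carries the ring instance with
  convolution as product.\<close>

datatype 'x series = Series (coeff: "'x list \<Rightarrow> int")

lemma series_eqI: "(\<And>z. coeff u z = coeff v z) \<Longrightarrow> u = v"
  by (cases u; cases v) auto

definition conv :: "('x list \<Rightarrow> int) \<Rightarrow> ('x list \<Rightarrow> int) \<Rightarrow> 'x list \<Rightarrow> int" where
  "conv u v z = (\<Sum>k\<le>length z. u (take k z) * v (drop k z))"

lemma conv_Nil [simp]: "conv u v [] = u [] * v []"
  by (simp add: conv_def)

text \<open>Recursion on the first letter: the cut before it is split off, and all other cuts
  convolve the left shift of \<open>u\<close>. Inductions on words rest on this form.\<close>

lemma conv_Cons: "conv u v (x # z) = u [] * v (x # z) + conv (\<lambda>y. u (x # y)) v z"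
  by (simp add: conv_def sum.atMost_Suc_shift del: sum.atMost_Suc)

lemma conv_add_left: "conv (\<lambda>y. u y + u' y) v z = conv u v z + conv u' v z"
  by (simp add: conv_def sum.distrib algebra_simps)

lemma conv_add_right: "conv u (\<lambda>y. v y + v' y) z = conv u v z + conv u v' z"
  by (simp add: conv_def sum.distrib algebra_simps)

lemma conv_scale_left: "conv (\<lambda>y. c * u y) v z = c * conv u v z"
  by (simp add: conv_def sum_distrib_left algebra_simps)

text \<open>Removing the first letter replaces \<open>u\<close> by its left shift, so the induction
  must keep \<open>u\<close> arbitrary; the remaining terms match by linearity.\<close>

lemma conv_assoc: "conv (conv u v) w z = conv u (conv v w) z"
proof (induction z arbitrary: u)
  case (Cons x z)
  show ?case
    by (simp add: conv_Cons[of _ _ x] conv_add_left conv_scale_left Cons.IH algebra_simps)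
qed simp

lemma conv_one_left: "conv (\<lambda>z. if z = [] then 1 else 0) v z = v z"
proof (cases z)
  case (Cons x y)
  then show ?thesis by (simp add: conv_Cons) (simp add: conv_def)
qed simp

lemma conv_one_right: "conv u (\<lambda>z. if z = [] then 1 else 0) z = u z"
  by (induction z arbitrary: u) (simp_all add: conv_Cons)

instantiation series :: (type) ring_1
begin

definition "0 = Series (\<lambda>_. 0)"
definition "1 = Series (\<lambda>z. if z = [] then 1 else 0)"
definition "u + v = Series (\<lambda>z. coeff u z + coeff v z)"
definition "- u = Series (\<lambda>z. - coeff u z)"
definition "u - v = Series (\<lambda>z. coeff u z - coeff v z)"
definition "u * v = Series (conv (coeff u) (coeff v))"

instance
proof
  fix a b c :: "'a series"
  show "a * b * c = a * (b * c)"
    by (rule series_eqI) (simp add: times_series_def conv_assoc)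
  show "1 * a = a" "a * 1 = a"
    by (rule series_eqI; simp add: times_series_def one_series_def conv_one_left conv_one_right)+
  show "(a + b) * c = a * c + b * c"
    by (rule series_eqI) (simp add: times_series_def plus_series_def conv_add_left)
  show "a * (b + c) = a * b + a * c"
    by (rule series_eqI) (simp add: times_series_def plus_series_def conv_add_right)
  show "(0 :: 'a series) \<noteq> 1"
  proof
    assume "(0 :: 'a series) = 1"
    then have "coeff (0 :: 'a series) [] = coeff 1 []" by simp
    then show False by (simp add: zero_series_def one_series_def)
  qed
qed (rule series_eqI; simp add: plus_series_def minus_series_def uminus_series_def zero_series_def)+

end

section \<open>Coefficients and order of a series\<close>

lemma coeff_simps [simp]:
  "coeff 0 z = 0" "coeff (u + v) z = coeff u z + coeff v z" "coeff (- u) z = - coeff u z"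
  "coeff (u - v) z = coeff u z - coeff v z"
  by (simp_all add: zero_series_def plus_series_def uminus_series_def minus_series_def)

lemma coeff_one: "coeff 1 z = (if z = [] then 1 else 0)"
  by (simp add: one_series_def)

lemma coeff_mult: "coeff (u * v) z = (\<Sum>k\<le>length z. coeff u (take k z) * coeff v (drop k z))"
  by (simp add: times_series_def conv_def)

lemma coeff_mult_Nil [simp]: "coeff (u * v) [] = coeff u [] * coeff v []"
  by (simp add: times_series_def)

lemma coeff_mult_single: "coeff (u * v) [x] = coeff u [] * coeff v [x] + coeff u [x] * coeff v []"
  by (simp add: times_series_def conv_Cons)

lemma coeff_sum: "coeff (sum f A) z = (\<Sum>i\<in>A. coeff (f i) z)"
  by (induction A rule: infinite_finite_induct) auto

text \<open>Serves with \<open>d = 0\<close> for the vanishing of coefficients and with a gcd of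
  letter orders for divisibility.\<close>

lemma dvd_coeff_mult:
  assumes "\<And>a b. z = a @ b \<Longrightarrow> d dvd coeff u a * coeff v b"
  shows "d dvd coeff (u * v) z"
  unfolding coeff_mult by (rule dvd_sum) (rule assms, simp)

text \<open>The ideal of series of order at least \<open>k\<close>; a difference lying in it
  expresses agreement in all degrees below \<open>k\<close>.\<close>

definition vanishing :: "nat \<Rightarrow> 'x series set" where
  "vanishing k = {u. \<forall>z. length z < k \<longrightarrow> coeff u z = 0}"

lemma vanishing_0 [simp]: "u \<in> vanishing 0"
  by (simp add: vanishing_def)

lemma vanishing_1_iff: "u \<in> vanishing 1 \<longleftrightarrow> coeff u [] = 0"
  by (auto simp: vanishing_def)

lemma vanishing_mono: "u \<in> vanishing k \<Longrightarrow> j \<le> k \<Longrightarrow> u \<in> vanishing j"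
  by (auto simp: vanishing_def)

lemma vanishing_add: "u \<in> vanishing k \<Longrightarrow> v \<in> vanishing k \<Longrightarrow> u + v \<in> vanishing k"
  and vanishing_diff: "u \<in> vanishing k \<Longrightarrow> v \<in> vanishing k \<Longrightarrow> u - v \<in> vanishing k"
  by (auto simp: vanishing_def)

lemma vanishing_trans: "u - v \<in> vanishing k \<Longrightarrow> v - w \<in> vanishing k \<Longrightarrow> u - w \<in> vanishing k"
  by (auto simp: vanishing_def)

lemma vanishing_mult:
  assumes "u \<in> vanishing j" "v \<in> vanishing k"
  shows "u * v \<in> vanishing (j + k)"
  unfolding vanishing_def
proof (intro CollectI allI impI)
  fix z :: "'a list" assume z: "length z < j + k"
  have "0 dvd coeff (u * v) z"
  proof (rule dvd_coeff_mult)
    fix a b assume "z = a @ b"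
    then have "length a < j \<or> length b < k" using z by auto
    then show "0 dvd coeff u a * coeff v b" using assms by (auto simp: vanishing_def)
  qed
  then show "coeff (u * v) z = 0" by simp
qed

lemma vanishing_power: "u \<in> vanishing 1 \<Longrightarrow> u ^ n \<in> vanishing n"
  using vanishing_mult[of u 1] by (induction n) auto

text \<open>In the lowest degree only the cut after \<open>j\<close> letters survives, since any
  other cut leaves one part too short.\<close>

lemma coeff_mult_vanishing:
  assumes "u \<in> vanishing j" "v \<in> vanishing k" "length x = j" "length y = k"
  shows "coeff (u * v) (x @ y) = coeff u x * coeff v y"
proof -
  have "coeff (u * v) (x @ y) =
      (\<Sum>i\<in>{j}. coeff u (take i (x @ y)) * coeff v (drop i (x @ y)))"
    unfolding coeff_mult
  proof (rule sum.mono_neutral_right)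
    show "\<forall>i\<in>{..length (x @ y)} - {j}. coeff u (take i (x @ y)) * coeff v (drop i (x @ y)) = 0"
    proof
      fix i assume "i \<in> {..length (x @ y)} - {j}"
      then have "length (take i (x @ y)) < j \<or> length (drop i (x @ y)) < k"
        using assms(3,4) by auto
      then show "coeff u (take i (x @ y)) * coeff v (drop i (x @ y)) = 0"
        using assms(1,2) unfolding vanishing_def by fastforce
    qed
  qed (use assms in auto)
  then show ?thesis using assms by simp
qed

text \<open>Without a constant term in \<open>x\<close>, the power \<open>x ^ n\<close> reaches only
  words of length at least \<open>n\<close>, so the finite sum is the coefficient of the infinite
  series.\<close>

definition geometric_series :: "'x series \<Rightarrow> 'x series" where
  "geometric_series x = Series (\<lambda>z. \<Sum>n\<le>length z. coeff (x ^ n) z)"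

lemma geometric_series_mult:
  fixes x :: "'x series"
  assumes x: "x \<in> vanishing 1"
  shows "geometric_series x * (1 - x) = 1"
proof (rule series_eqI)
  fix z :: "'x list"
  let ?S = "\<lambda>k. \<Sum>n\<le>k. x ^ n"
  have S: "?S k * (1 - x) = 1 - x ^ Suc k" for k
  proof (induction k)
    case (Suc k)
    have "?S (Suc k) * (1 - x) = ?S k * (1 - x) + x ^ Suc k * (1 - x)"
      by (simp add: distrib_right)
    also have "\<dots> = 1 - x ^ Suc (Suc k)"
      unfolding Suc by (simp add: right_diff_distrib mult.assoc power_commutes)
    finally show ?case .
  qed simp
  \<comment> \<open>At each single word the series may be replaced by a partial sum, for which the
    product telescopes.\<close>
  have R: "geometric_series x - ?S k \<in> vanishing (Suc k)" for k
    unfolding vanishing_def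
  proof (intro CollectI allI impI)
    fix z :: "'x list" assume "length z < Suc k"
    then have "(\<Sum>n\<le>k. coeff (x ^ n) z) = (\<Sum>n\<le>length z. coeff (x ^ n) z)"
      using vanishing_power[OF x] by (intro sum.mono_neutral_right) (auto simp: vanishing_def)
    then show "coeff (geometric_series x - ?S k) z = 0"
      by (simp add: geometric_series_def coeff_sum)
  qed
  let ?k = "length z"
  have "geometric_series x * (1 - x) - 1 = (geometric_series x - ?S ?k) * (1 - x) - x ^ Suc ?k"
    unfolding left_diff_distrib[of _ _ "1 - x"] S by simp
  also have "\<dots> \<in> vanishing (Suc ?k)"
    using vanishing_mult[OF R vanishing_0, of ?k "1 - x"] vanishing_power[OF x, of "Suc ?k"]
    by (intro vanishing_diff) auto
  finally have "coeff (geometric_series x * (1 - x) - 1) z = 0"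
    unfolding vanishing_def by blast
  then show "coeff (geometric_series x * (1 - x)) z = coeff 1 z" by simp
qed

section \<open>The group of series with constant term 1\<close>

definition unit_series :: "'x series monoid" where
  "unit_series = \<lparr>carrier = {u. coeff u [] = 1}, monoid.mult = (*), one = 1\<rparr>"

lemma unit_series_simps [simp]:
  "u \<in> carrier unit_series \<longleftrightarrow> coeff u [] = 1"
  "u \<otimes>\<^bsub>unit_series\<^esub> v = u * v" "\<one>\<^bsub>unit_series\<^esub> = 1"
  by (simp_all add: unit_series_def)

lemma unit_series_vanishing: "u \<in> carrier unit_series \<longleftrightarrow> u - 1 \<in> vanishing 1"
  unfolding vanishing_1_iff by (simp add: coeff_one)

lemma group_unit_series: "group unit_series"
proof (rule groupI)
  fix u :: "'a series" assume u: "u \<in> carrier unit_series"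
  then have "1 - u \<in> vanishing 1" unfolding vanishing_1_iff by (simp add: coeff_one)
  from geometric_series_mult[OF this] have "geometric_series (1 - u) * u = 1" by simp
  then show "\<exists>v\<in>carrier unit_series. v \<otimes>\<^bsub>unit_series\<^esub> u = \<one>\<^bsub>unit_series\<^esub>"
    by (intro bexI[of _ "geometric_series (1 - u)"]) (simp_all add: geometric_series_def coeff_one)
qed (auto simp: coeff_one mult.assoc)

interpretation unit_series: group unit_series
  by (rule group_unit_series)

text \<open>With \<open>u = P - 1\<close> and \<open>v = Q - 1\<close>, the commutator minus 1 is
  \<open>P^-1 Q^-1 (P Q - Q P)\<close>, and \<open>P Q - Q P = u v - v u\<close>. The factor in
  front has constant term 1 and leaves the leading term alone, which is the Lie commutator of
  \<open>p\<close> and \<open>q\<close>.\<close>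

lemma commutator_leading_term:
  assumes P: "P \<in> carrier unit_series" "p \<in> vanishing a" "P - 1 - p \<in> vanishing (a + 1)"
    and Q: "Q \<in> carrier unit_series" "q \<in> vanishing b" "Q - 1 - q \<in> vanishing (b + 1)"
  shows "(inv\<^bsub>unit_series\<^esub> P \<otimes>\<^bsub>unit_series\<^esub> inv\<^bsub>unit_series\<^esub> Q) \<otimes>\<^bsub>unit_series\<^esub> (P \<otimes>\<^bsub>unit_series\<^esub> Q)
      - 1 - (p * q - q * p) \<in> vanishing (a + b + 1)" (is "?C - 1 - _ \<in> _")
    and "p * q - q * p \<in> vanishing (a + b)"
proof -
  show pq: "p * q - q * p \<in> vanishing (a + b)"
    using vanishing_mult[OF P(2) Q(2)] vanishing_mult[OF Q(2) P(2)]
    by (intro vanishing_diff) (auto simp: add.commute)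
  let ?P = "inv\<^bsub>unit_series\<^esub> P" and ?Q = "inv\<^bsub>unit_series\<^esub> Q"
  let ?u = "P - 1" and ?v = "Q - 1"
  have c: "?P \<in> carrier unit_series" "?Q \<in> carrier unit_series" using P(1) Q(1) by blast+
  have u: "?u \<in> vanishing a" using vanishing_add[OF P(2) vanishing_mono[OF P(3)]] by simp
  have v: "?v \<in> vanishing b" using vanishing_add[OF Q(2) vanishing_mono[OF Q(3)]] by simp
  have one: "?P * P = 1" "?Q * Q = 1"
    using unit_series.l_inv[OF P(1)] unit_series.l_inv[OF Q(1)] by simp_all
  let ?X = "?u * ?v - ?v * ?u"
  \<comment> \<open>Factors are replaced one at a time, so that each summand contains an error of
    order one higher.\<close>
  have "?X - (p * q - q * p) = ((?u - p) * ?v + p * (?v - q)) - ((?v - q) * ?u + q * (?u - p))"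
    by (simp add: algebra_simps)
  also have "\<dots> \<in> vanishing (a + b + 1)"
    using vanishing_mult[OF P(3) v] vanishing_mult[OF P(2) Q(3)]
      vanishing_mult[OF Q(3) u] vanishing_mult[OF Q(2) P(3)]
    by (intro vanishing_diff vanishing_add) (simp_all add: add_ac)
  finally have X: "?X - (p * q - q * p) \<in> vanishing (a + b + 1)" .
  then have "?X \<in> vanishing (a + b)"
    using vanishing_add[OF pq vanishing_mono[OF X, of "a + b"]] by simp
  moreover have "?P * ?Q - 1 \<in> vanishing 1"
    using c unfolding vanishing_1_iff by (simp add: coeff_one)
  ultimately have "(?P * ?Q - 1) * ?X \<in> vanishing (1 + (a + b))" by (rule vanishing_mult[rotated])
  moreover have "?C - 1 - ?X = (?P * ?Q - 1) * ?X"
  proof -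
    have "?P * (?Q * (Q * P)) = 1" using one by (simp flip: mult.assoc[of ?Q])
    moreover have "?X = P * Q - Q * P" by (simp add: algebra_simps)
    ultimately show ?thesis by (simp add: left_diff_distrib right_diff_distrib mult.assoc)
  qed
  ultimately have "?C - 1 - ?X \<in> vanishing (a + b + 1)" by (simp add: add_ac)
  from vanishing_trans[OF this X] show "?C - 1 - (p * q - q * p) \<in> vanishing (a + b + 1)" .
qed

text \<open>Orders add under commutators, here with all of \<open>P - 1\<close> taken as leading
  term, and the numbers of variables add by disjointness.\<close>

lemma outer_commutator_vanishing:
  assumes "outer_commutator w" "\<forall>x. g x \<in> carrier unit_series"
  shows "word_value unit_series g w - 1 \<in> vanishing (card (word_vars w))"
  using assms
proof (induction w rule: outer_commutator.induct)
  case (Var i)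
  then show ?case using unit_series_vanishing by fastforce
next
  case (comm u v)
  let ?W = "word_value unit_series g"
  have cl: "?W u \<in> carrier unit_series" "?W v \<in> carrier unit_series"
    using word_value_closed[OF group_unit_series comm.prems] by blast+
  have "card (word_vars (comm_word u v)) = card (word_vars u) + card (word_vars v)"
    using comm.hyps by (simp add: card_Un_disjoint finite_word_vars)
  moreover
  note lead = commutator_leading_term[OF cl(1) comm.IH(1)[OF comm.prems] _ cl(2) comm.IH(2)[OF comm.prems]]
  have "?W (comm_word u v) - 1 \<in> vanishing (card (word_vars u) + card (word_vars v))"
    unfolding word_value_comm_word
    using vanishing_add[OF vanishing_mono[OF lead(1)] lead(2)] by (simp add: vanishing_def)
  ultimately show ?case by simp
qed

section \<open>Reduction of coefficients\<close>

text \<open>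
  Coefficients of words of length at most \<open>k\<close> are read modulo the common divisor of the orders
  \<open>m l\<close> of their letters, where order \<open>0\<close> means infinite order; longer words are ignored.
\<close>

definition letter_gcd :: "('x \<Rightarrow> nat) \<Rightarrow> 'x list \<Rightarrow> int" where
  "letter_gcd m z = Gcd ((\<lambda>l. int (m l)) ` set z)"

definition divisible :: "('x \<Rightarrow> nat) \<Rightarrow> nat \<Rightarrow> 'x series set" where
  "divisible m k = {u. \<forall>z. length z \<le> k \<longrightarrow> letter_gcd m z dvd coeff u z}"

lemma letter_gcd_dvd: "l \<in> set z \<Longrightarrow> letter_gcd m z dvd int (m l)"
  unfolding letter_gcd_def by (rule Gcd_dvd) simp

lemma letter_gcd_mono: "set y \<subseteq> set z \<Longrightarrow> letter_gcd m z dvd letter_gcd m y"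
  unfolding letter_gcd_def by (rule Gcd_greatest) (auto intro: Gcd_dvd)

text \<open>The empty gcd is 0, so a series in \<open>divisible m k\<close> has constant term
  exactly 0.\<close>

lemma letter_gcd_simps [simp]: "letter_gcd m [] = 0" "letter_gcd m [l] = int (m l)"
  by (simp_all add: letter_gcd_def)

lemma divisible_add: "u \<in> divisible m k \<Longrightarrow> v \<in> divisible m k \<Longrightarrow> u + v \<in> divisible m k"
  and divisible_diff: "u \<in> divisible m k \<Longrightarrow> v \<in> divisible m k \<Longrightarrow> u - v \<in> divisible m k"
  and divisible_minus: "u \<in> divisible m k \<Longrightarrow> - u \<in> divisible m k"
  by (auto simp: divisible_def)

lemma vanishing_divisible: "u \<in> vanishing (Suc k) \<Longrightarrow> u \<in> divisible m k"
  by (auto simp: vanishing_def divisible_def)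

text \<open>If a word has at most \<open>j + k\<close> letters and its left part at least
  \<open>j\<close>, the right part has at most \<open>k\<close>; and the gcd over all letters
  divides the gcd over those of a part.\<close>

lemma divisible_mult_left:
  assumes "u \<in> vanishing j" "v \<in> divisible m k"
  shows "u * v \<in> divisible m (j + k)"
  unfolding divisible_def
proof (intro CollectI allI impI dvd_coeff_mult)
  fix z a b :: "'a list" assume z: "length z \<le> j + k" "z = a @ b"
  show "letter_gcd m z dvd coeff u a * coeff v b"
  proof (cases "length a < j")
    case True
    then show ?thesis using assms(1) by (simp add: vanishing_def)
  next
    case False
    then have "letter_gcd m b dvd coeff v b" using assms(2) z by (auto simp: divisible_def)
    then show ?thesis using letter_gcd_mono[of b z m] z by (auto intro: dvd_mult dvd_trans)
  qed
qed

lemma divisible_mult_right: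
  assumes "u \<in> divisible m k" "v \<in> vanishing j"
  shows "u * v \<in> divisible m (k + j)"
  unfolding divisible_def
proof (intro CollectI allI impI dvd_coeff_mult)
  fix z a b :: "'a list" assume z: "length z \<le> k + j" "z = a @ b"
  show "letter_gcd m z dvd coeff u a * coeff v b"
  proof (cases "length b < j")
    case True
    then show ?thesis using assms(2) by (simp add: vanishing_def)
  next
    case False
    then have "letter_gcd m a dvd coeff u a" using assms(1) z by (auto simp: divisible_def)
    then show ?thesis using letter_gcd_mono[of a z m] z by (auto intro: dvd_mult2 dvd_trans)
  qed
qed

lemmas divisible_ideal = divisible_mult_left[OF vanishing_0, simplified]
  divisible_mult_right[OF _ vanishing_0, simplified]

text \<open>Up to degree the weight of the word, a value is 1 plus the Lie commutator of its two
  halves. Exchanging the factors one at a time leaves products of a divisible difference and a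
  series of known order, and the degrees add. So only linear parts matter.\<close>

lemma outer_commutator_congruent:
  assumes "outer_commutator w" "\<forall>x. g x \<in> carrier unit_series" "\<forall>x. h x \<in> carrier unit_series"
    and "\<forall>x. g x - h x \<in> divisible m 1"
  shows "word_value unit_series g w - word_value unit_series h w \<in> divisible m (card (word_vars w))"
  using assms
proof (induction w rule: outer_commutator.induct)
  case (comm u v)
  let ?a = "card (word_vars u)" and ?b = "card (word_vars v)"
  have card: "card (word_vars (comm_word u v)) = ?a + ?b"
    using comm.hyps by (simp add: card_Un_disjoint finite_word_vars)
  let ?W = "word_value unit_series"
  let ?X = "(\<lambda>f. (?W f u - 1) * (?W f v - 1) - (?W f v - 1) * (?W f u - 1))"
  have lead: "?W f (comm_word u v) - 1 - ?X f \<in> divisible m (?a + ?b)"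
    if f: "\<forall>x. f x \<in> carrier unit_series" for f
  proof -
    have cl: "?W f u \<in> carrier unit_series" "?W f v \<in> carrier unit_series"
      using word_value_closed[OF group_unit_series f] by blast+
    have "?W f (comm_word u v) - 1 - ?X f \<in> vanishing (?a + ?b + 1)"
      unfolding word_value_comm_word
      by (rule commutator_leading_term(1)[OF cl(1) outer_commutator_vanishing[OF comm.hyps(1) f] _
            cl(2) outer_commutator_vanishing[OF comm.hyps(2) f]]) (simp_all add: vanishing_def)
    then show ?thesis using vanishing_divisible by simp
  qed
  let ?P = "?W g u - 1" and ?Q = "?W g v - 1" and ?P' = "?W h u - 1" and ?Q' = "?W h v - 1"
  have PQ: "?P \<in> vanishing ?a" "?Q \<in> vanishing ?b" "?P' \<in> vanishing ?a" "?Q' \<in> vanishing ?b"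
    using outer_commutator_vanishing comm by blast+
  have IH: "?P - ?P' \<in> divisible m ?a" "?Q - ?Q' \<in> divisible m ?b"
    using comm.IH[OF comm.prems] by simp_all
  have "?X g - ?X h = ((?P - ?P') * ?Q + ?P' * (?Q - ?Q')) - ((?Q - ?Q') * ?P + ?Q' * (?P - ?P'))"
    by (simp only: right_diff_distrib left_diff_distrib) simp
  also have "\<dots> \<in> divisible m (?a + ?b)"
    using divisible_mult_right[OF IH(1) PQ(2)] divisible_mult_left[OF PQ(3) IH(2)]
      divisible_mult_right[OF IH(2) PQ(1)] divisible_mult_left[OF PQ(4) IH(1)]
    by (intro divisible_diff divisible_add) (simp_all add: add.commute)
  finally have "?X g - ?X h \<in> divisible m (?a + ?b)" .
  from divisible_add[OF divisible_diff[OF lead lead] this, OF comm.prems(1,2)]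
  show ?case unfolding card by simp
qed simp

section \<open>Congruence subgroups of the series group\<close>

definition congruence_subgroup :: "('x \<Rightarrow> nat) \<Rightarrow> nat \<Rightarrow> 'x series set" where
  "congruence_subgroup m k = {u \<in> carrier unit_series. u - 1 \<in> divisible m k}"

text \<open>All closure properties follow from \<open>divisible m k\<close> absorbing products on
  both sides, for example through \<open>u v - 1 = u (v - 1) + (u - 1)\<close>.\<close>

lemma normal_congruence_subgroup: "congruence_subgroup m k \<lhd> unit_series"
proof (rule unit_series.normal_invI[OF unit_series.subgroupI])
  show "congruence_subgroup m k \<subseteq> carrier unit_series"
    by (auto simp: congruence_subgroup_def)
  have "1 \<in> congruence_subgroup m k"
    by (simp add: congruence_subgroup_def coeff_one divisible_def)
  then show "congruence_subgroup m k \<noteq> {}" by blast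
next
  fix u :: "'a series" assume "u \<in> congruence_subgroup m k"
  then have u: "u \<in> carrier unit_series" "u - 1 \<in> divisible m k"
    unfolding congruence_subgroup_def by blast+
  let ?u = "inv\<^bsub>unit_series\<^esub> u"
  have uc: "?u \<in> carrier unit_series" using u(1) by blast
  have "?u * u = 1" using unit_series.l_inv[OF u(1)] by simp
  then have "?u - 1 = - (?u * (u - 1))" by (simp add: right_diff_distrib)
  then have "?u - 1 \<in> divisible m k" using divisible_minus[OF divisible_ideal(1)[OF u(2)]] by simp
  then show "?u \<in> congruence_subgroup m k" using uc unfolding congruence_subgroup_def by blast
next
  fix u v :: "'a series" assume "u \<in> congruence_subgroup m k" "v \<in> congruence_subgroup m k"
  then have uv: "u \<in> carrier unit_series" "u - 1 \<in> divisible m k"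
      "v \<in> carrier unit_series" "v - 1 \<in> divisible m k"
    unfolding congruence_subgroup_def by blast+
  have "u * v - 1 = u * (v - 1) + (u - 1)" by (simp add: right_diff_distrib)
  also have "\<dots> \<in> divisible m k"
    by (rule divisible_add[OF divisible_ideal(1)[OF uv(4)] uv(2)])
  finally show "u \<otimes>\<^bsub>unit_series\<^esub> v \<in> congruence_subgroup m k"
    using uv(1,3) unfolding congruence_subgroup_def by simp
next
  fix x u :: "'a series" assume x: "x \<in> carrier unit_series" and "u \<in> congruence_subgroup m k"
  then have u: "u \<in> carrier unit_series" "u - 1 \<in> divisible m k"
    unfolding congruence_subgroup_def by blast+
  let ?x = "inv\<^bsub>unit_series\<^esub> x"
  have "x * ?x = 1" using unit_series.r_inv[OF x] by simp
  then have "x * u * ?x - 1 = x * (u - 1) * ?x" by (simp add: right_diff_distrib left_diff_distrib)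
  moreover have "x * u * ?x \<in> carrier unit_series"
    using x u(1) unit_series.inv_closed[OF x] by simp
  ultimately show "x \<otimes>\<^bsub>unit_series\<^esub> u \<otimes>\<^bsub>unit_series\<^esub> ?x \<in> congruence_subgroup m k"
    using divisible_ideal(2)[OF divisible_ideal(1)[OF u(2)]] unfolding congruence_subgroup_def by simp
qed

text \<open>\<open>u v^-1 - 1\<close> equals \<open>(u - v) v^-1\<close>, and multiplication by a
  unit does not affect divisibility.\<close>

lemma congruence_coset_eq:
  assumes u: "u \<in> carrier unit_series" and v: "v \<in> carrier unit_series"
  shows "congruence_subgroup m k #>\<^bsub>unit_series\<^esub> u = congruence_subgroup m k #>\<^bsub>unit_series\<^esub> v
    \<longleftrightarrow> u - v \<in> divisible m k"
proof -
  have sub: "subgroup (congruence_subgroup m k) unit_series"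
    using normal_congruence_subgroup normal_imp_subgroup by blast
  let ?v = "inv\<^bsub>unit_series\<^esub> v"
  have vc: "?v \<in> carrier unit_series" using v by blast
  have vv: "?v * v = 1" "v * ?v = 1"
    using unit_series.l_inv[OF v] unit_series.r_inv[OF v] by simp_all
  have "congruence_subgroup m k #>\<^bsub>unit_series\<^esub> u = congruence_subgroup m k #>\<^bsub>unit_series\<^esub> v
      \<longleftrightarrow> u * ?v \<in> congruence_subgroup m k"
    using unit_series.repr_independence unit_series.repr_independenceD
      subgroup.rcos_module[OF sub group_unit_series v u] sub u v unit_series_simps(2) by metis
  also have "\<dots> \<longleftrightarrow> u * ?v - 1 \<in> divisible m k"
    using u vc unfolding congruence_subgroup_def by simp
  also have "\<dots> \<longleftrightarrow> u - v \<in> divisible m k"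
  proof
    assume "u * ?v - 1 \<in> divisible m k"
    from divisible_ideal(2)[OF this, of v] show "u - v \<in> divisible m k"
      using vv by (simp add: left_diff_distrib mult.assoc)
  next
    assume "u - v \<in> divisible m k"
    from divisible_ideal(2)[OF this, of ?v] show "u * ?v - 1 \<in> divisible m k"
      using vv by (simp add: left_diff_distrib)
  qed
  finally show ?thesis .
qed

text \<open>Allows a copy of the quotient in any infinite type. A word with a letter of order 1
  imposes no condition, so finitely many integers determine a coset.\<close>

lemma countable_congruence_quotient:
  assumes "finite {l. m l \<noteq> 1}"
  shows "countable (carrier (unit_series Mod congruence_subgroup m k))"
proof -
  let ?K = "congruence_subgroup m k"
  let ?Z = "{z. set z \<subseteq> {l. m l \<noteq> 1} \<and> length z \<le> k}"
  obtain zs where zs: "set zs = ?Z"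
    using finite_list[OF finite_lists_length_le[OF assms]] by blast
  \<comment> \<open>For gcd 0 the residue is the coefficient itself, as reduction modulo 0 is the
    identity.\<close>
  define r where "r u = map (\<lambda>z. coeff u z mod letter_gcd m z) zs" for u
  define h where "h s = ?K #>\<^bsub>unit_series\<^esub> (SOME u. u \<in> carrier unit_series \<and> r u = s)" for s
  have diff: "u - v \<in> divisible m k" if "r u = r v" for u v
    unfolding divisible_def
  proof (intro CollectI allI impI)
    fix z :: "'a list" assume z: "length z \<le> k"
    show "letter_gcd m z dvd coeff (u - v) z"
    proof (cases "z \<in> ?Z")
      case True
      then have "coeff u z mod letter_gcd m z = coeff v z mod letter_gcd m z"
        using that zs unfolding r_def by (metis (mono_tags, lifting) map_eq_conv)
      then show ?thesis by (simp add: mod_eq_dvd_iff)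
    next
      case False
      then obtain l where "l \<in> set z" "m l = 1" using z by auto
      then have "letter_gcd m z dvd 1" using letter_gcd_dvd[of l z m] by simp
      then show ?thesis by (meson dvd_trans one_dvd)
    qed
  qed
  have "?K #>\<^bsub>unit_series\<^esub> u = h (r u)" if u: "u \<in> carrier unit_series" for u
  proof -
    define v where "v = (SOME v. v \<in> carrier unit_series \<and> r v = r u)"
    have v: "v \<in> carrier unit_series \<and> r v = r u"
      unfolding v_def by (rule someI[of _ u]) (use u in blast)
    have "h (r u) = ?K #>\<^bsub>unit_series\<^esub> v" by (simp only: h_def v_def)
    moreover have "?K #>\<^bsub>unit_series\<^esub> u = ?K #>\<^bsub>unit_series\<^esub> v"
      using v diff[of u v] congruence_coset_eq[OF u, of v] by simp
    ultimately show ?thesis by simp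
  qed
  then have "carrier (unit_series Mod ?K) \<subseteq> range h"
    by (auto simp: FactGroup_def RCOSETS_def)
  then show ?thesis by (rule countable_subset) simp
qed

section \<open>A criterion for varietal capability\<close>

text \<open>Every tuple in \<open>E\<close> lifts to \<open>U\<close>, so marginality in the
  quotient is tested on values computed in \<open>U\<close>.\<close>

lemma marginal_hom_image:
  fixes V :: "'x group_word set"
  assumes "group_hom U E p" "p ` carrier U = carrier E" "a \<in> carrier U"
  shows "p a \<in> marginal V E \<longleftrightarrow> (\<forall>v\<in>V. \<forall>g. (\<forall>x. g x \<in> carrier U) \<longrightarrow> (\<forall>i\<in>word_vars v.
    p (word_value U (g(i := g i \<otimes>\<^bsub>U\<^esub> a)) v) = p (word_value U g v)))" (is "?L \<longleftrightarrow> ?R")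
proof -
  interpret group_hom U E p by fact
  have upd: "(\<lambda>x. p ((g(i := g i \<otimes>\<^bsub>U\<^esub> a)) x)) = (\<lambda>x. p (g x))(i := p (g i) \<otimes>\<^bsub>E\<^esub> p a)"
    if "\<forall>x. g x \<in> carrier U" for g i
    using that assms(3) by auto
  have val: "p (word_value U (g(i := g i \<otimes>\<^bsub>U\<^esub> a)) v) =
      word_value E ((\<lambda>x. p (g x))(i := p (g i) \<otimes>\<^bsub>E\<^esub> p a)) v"
    if g: "\<forall>x. g x \<in> carrier U" for g i v
  proof -
    have "\<forall>x. (g(i := g i \<otimes>\<^bsub>U\<^esub> a)) x \<in> carrier U" using g assms(3) by simp
    from word_value_hom[OF assms(1) this, of v, symmetric] show ?thesis unfolding upd[OF g] .
  qed
  show ?thesis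
  proof
    assume L: ?L
    show ?R
    proof (intro ballI allI impI)
      fix v i and g :: "'x \<Rightarrow> _" assume v: "v \<in> V" "\<forall>x. g x \<in> carrier U" "i \<in> word_vars v"
      then show "p (word_value U (g(i := g i \<otimes>\<^bsub>U\<^esub> a)) v) = p (word_value U g v)"
        using marginalD[OF L v(1) _ v(3), of "\<lambda>x. p (g x)"] val[OF v(2)]
          word_value_hom[OF assms(1) v(2)] by simp
    qed
  next
    assume R: ?R
    show ?L unfolding marginal_def
    proof (intro CollectI conjI ballI allI impI)
      fix v i and h :: "'x \<Rightarrow> _" assume v: "v \<in> V" "\<forall>x. h x \<in> carrier E" "i \<in> word_vars v"
      then have "\<forall>x. \<exists>y\<in>carrier U. p y = h x" using assms(2) by (metis imageE)
      then obtain g where g: "\<forall>x. g x \<in> carrier U" "h = (\<lambda>x. p (g x))" by metis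
      show "word_value E (h(i := h i \<otimes>\<^bsub>E\<^esub> p a)) v = word_value E h v"
      proof -
        have "p (word_value U (g(i := g i \<otimes>\<^bsub>U\<^esub> a)) v) = p (word_value U g v)"
          using R v g(1) by blast
        then show ?thesis
          unfolding val[OF g(1)] word_value_hom[OF assms(1) g(1), symmetric] g(2) .
      qed
    qed (use assms(3) in simp)
  qed
qed

text \<open>\<open>G\<close> and the quotient of \<open>E\<close> by its marginal subgroup are both
  images of \<open>U\<close> with the same kernel.\<close>

lemma varietal_capableI:
  fixes E :: "'e monoid"
  assumes p: "group_hom U E p" "p ` carrier U = carrier E"
    and \<psi>: "group_hom U G \<psi>" "\<psi> ` carrier U = carrier G"
    and ker: "\<And>a. a \<in> carrier U \<Longrightarrow> \<psi> a = \<one>\<^bsub>G\<^esub> \<longleftrightarrow> p a \<in> marginal V E"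
  shows "varietal_capable TYPE('e) V G"
proof -
  interpret p: group_hom U E p by fact
  interpret \<psi>: group_hom U G \<psi> by fact
  interpret N: normal "marginal V E" E by (rule p.H.normal_marginal)
  define q where "q = (#>\<^bsub>E\<^esub>) (marginal V E) \<circ> p"
  have q: "group_hom U (E Mod marginal V E) q"
    unfolding q_def group_hom_def group_hom_axioms_def
    using N.factorgroup_is_group p.G.is_group Group.hom_compose[OF p.homh N.r_coset_hom_Mod] by blast
  have surj: "q ` carrier U = carrier (E Mod marginal V E)"
    unfolding q_def image_comp[symmetric] p(2) by (auto simp: FactGroup_def RCOSETS_def)
  have "q a = \<one>\<^bsub>E Mod marginal V E\<^esub> \<longleftrightarrow> p a \<in> marginal V E" if "a \<in> carrier U" for a
    using that N.is_subgroup p.H.coset_join1 p.H.coset_join2 p.hom_closed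
    unfolding q_def comp_def by (metis (no_types, lifting) monoid.simps(2) FactGroup_def)
  then have "kernel U (E Mod marginal V E) q = kernel U G \<psi>"
    using ker by (auto simp: kernel_def)
  then have "U Mod kernel U G \<psi> \<cong> E Mod marginal V E"
    using group_hom.FactGroup_iso[OF q surj] by simp
  moreover have "G \<cong> U Mod kernel U G \<psi>"
    using group.iso_sym[OF normal.factorgroup_is_group[OF \<psi>.normal_kernel] \<psi>.FactGroup_iso[OF \<psi>(2)]] .
  ultimately have "G \<cong> E Mod marginal V E" by (rule iso_trans[rotated])
  with p.H.is_group show ?thesis unfolding varietal_capable_def by blast
qed

text \<open>An infinite type contains a copy of the natural numbers, hence of every countable
  carrier; the group structure is transported along the injection.\<close>

lemma countable_group_copy:
  assumes "group F" "countable (carrier F)" "infinite (UNIV :: 'e set)"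
  obtains E :: "'e monoid" and f where "group E" "f \<in> iso F E"
proof -
  obtain e :: "nat \<Rightarrow> 'e" where e: "inj e"
    using infinite_countable_subset[OF assms(3)] by blast
  obtain c :: "_ \<Rightarrow> nat" where c: "inj_on c (carrier F)" using assms(2) by (rule countableE)
  have inj: "inj_on (e \<circ> c) (carrier F)"
    using c e by (simp add: comp_inj_on inj_on_subset)
  have "group (image_group (e \<circ> c) F)"
    using group.iso_imp_img_group[OF assms(1) inj_imp_image_group_iso[OF inj]]
    by (simp add: image_group_def)
  then show ?thesis using inj_imp_image_group_iso[OF inj] by (rule that)
qed

lemma outer_commutator_one:
  assumes "outer_commutator w" "i \<in> word_vars w" "group E" "\<forall>x. g x \<in> carrier E" "g i = \<one>\<^bsub>E\<^esub>"
  shows "word_value E g w = \<one>\<^bsub>E\<^esub>"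
proof -
  interpret group E by fact
  show ?thesis using assms(1,2)
  proof (induction w rule: outer_commutator.induct)
    case (comm u v)
    then have "word_value E g u = \<one>\<^bsub>E\<^esub> \<or> word_value E g v = \<one>\<^bsub>E\<^esub>" by auto
    then show ?case
      using word_value_closed[OF is_group assms(4)] by (auto simp: word_value_comm_word)
  qed (use assms(5) in simp)
qed

text \<open>\<open>E\<close> is a copy of the series group with coefficients reduced up to the
  weight of \<open>w\<close>. The hypothesis \<open>ker\<close> makes the kernel of
  \<open>\<psi>\<close> the series with trivial reduced linear part: these are marginal by
  \<open>outer_commutator_congruent\<close>, and \<open>detect\<close> excludes all others.\<close>

theorem varietal_capable_if_detected:
  fixes w :: "'y group_word" and m :: "'x \<Rightarrow> nat" and \<psi> :: "'x series \<Rightarrow> 'a"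
  assumes w: "outer_commutator w"
    and \<psi>: "group_hom unit_series G \<psi>" "\<psi> ` carrier unit_series = carrier G"
    and ker: "\<And>a. a \<in> carrier unit_series \<Longrightarrow> \<psi> a = \<one>\<^bsub>G\<^esub> \<longleftrightarrow> (\<forall>l. int (m l) dvd coeff a [l])"
    and fin: "finite {l. m l \<noteq> 1}" and inf: "infinite (UNIV :: 'e set)"
    and detect: "\<And>a l. a \<in> carrier unit_series \<Longrightarrow> \<not> int (m l) dvd coeff a [l] \<Longrightarrow>
      \<exists>i\<in>word_vars w. \<exists>g. (\<forall>x. g x \<in> carrier unit_series) \<and>
        word_value unit_series (g(i := a)) w - 1 \<notin> divisible m (card (word_vars w))"
  shows "varietal_capable TYPE('e) {w} G"
proof -
  let ?N = "card (word_vars w)" and ?W = "word_value unit_series"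
  let ?K = "congruence_subgroup m ?N"
  let ?F = "unit_series Mod ?K"
  have F: "group ?F" by (rule normal.factorgroup_is_group[OF normal_congruence_subgroup])
  obtain E :: "'e monoid" and f where E: "group E" and f: "f \<in> iso ?F E"
    using countable_group_copy[OF F countable_congruence_quotient[OF fin] inf] .
  define p where "p u = f (?K #>\<^bsub>unit_series\<^esub> u)" for u
  have cosets: "(#>\<^bsub>unit_series\<^esub>) ?K ` carrier unit_series = carrier ?F"
    by (auto simp: FactGroup_def RCOSETS_def)
  have "f \<circ> (#>\<^bsub>unit_series\<^esub>) ?K \<in> hom unit_series E"
    using normal.r_coset_hom_Mod[OF normal_congruence_subgroup] f
    by (intro Group.hom_compose) (auto simp: iso_def)
  then have p: "group_hom unit_series E p"
    unfolding group_hom_def group_hom_axioms_def p_def comp_def using E group_unit_series by simp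
  have psurj: "p ` carrier unit_series = carrier E"
  proof -
    have "p ` carrier unit_series = f ` ((#>\<^bsub>unit_series\<^esub>) ?K ` carrier unit_series)"
      by (auto simp: p_def)
    with f show ?thesis unfolding cosets by (simp add: iso_def bij_betw_def)
  qed
  have peq: "p u = p v \<longleftrightarrow> u - v \<in> divisible m ?N"
    if uv: "u \<in> carrier unit_series" "v \<in> carrier unit_series" for u v
  proof -
    have "inj_on f (carrier ?F)" using f by (simp add: iso_def bij_betw_def)
    then have "p u = p v \<longleftrightarrow> ?K #>\<^bsub>unit_series\<^esub> u = ?K #>\<^bsub>unit_series\<^esub> v"
      unfolding p_def by (rule inj_on_eq_iff) (use uv cosets in blast)+
    then show ?thesis using congruence_coset_eq[OF uv] by simp
  qed
  show ?thesis
  proof (rule varietal_capableI[OF p psurj \<psi>])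
    fix a :: "'x series" assume a: "a \<in> carrier unit_series"
    show "\<psi> a = \<one>\<^bsub>G\<^esub> \<longleftrightarrow> p a \<in> marginal {w} E"
    proof
      assume "\<psi> a = \<one>\<^bsub>G\<^esub>"
      then have al: "\<forall>l. int (m l) dvd coeff a [l]" using ker a by blast
      have a1: "a - 1 \<in> divisible m 1"
        unfolding divisible_def
      proof (intro CollectI allI impI)
        fix z :: "'x list" assume "length z \<le> 1"
        then consider "z = []" | l where "z = [l]" by (cases z) auto
        then show "letter_gcd m z dvd coeff (a - 1) z"
          using al a by cases (auto simp: coeff_one)
      qed
      show "p a \<in> marginal {w} E"
        unfolding marginal_hom_image[OF p psurj a]
      proof (intro ballI allI impI; (elim singletonE)?)
        fix v i and g :: "'y \<Rightarrow> 'x series"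
        assume v: "v = w" and g: "\<forall>x. g x \<in> carrier unit_series" and i: "i \<in> word_vars v"
        let ?g = "g(i := g i \<otimes>\<^bsub>unit_series\<^esub> a)"
        have g': "\<forall>x. ?g x \<in> carrier unit_series" using g a by simp
        have "?g x - g x \<in> divisible m 1" for x
        proof (cases "x = i")
          case True
          then have "?g x - g x = g i * (a - 1)" by (simp add: right_diff_distrib)
          then show ?thesis using divisible_ideal(1)[OF a1] by simp
        qed (simp add: divisible_def)
        then have "?W ?g w - ?W g w \<in> divisible m ?N"
          by (intro outer_commutator_congruent[OF w g' g]) blast
        then show "p (?W ?g v) = p (?W g v)"
          unfolding v using peq word_value_closed[OF group_unit_series] g g' by blast
      qed
    next
      assume R: "p a \<in> marginal {w} E"
      show "\<psi> a = \<one>\<^bsub>G\<^esub>"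
      proof (rule ccontr)
        assume "\<psi> a \<noteq> \<one>\<^bsub>G\<^esub>"
        then obtain l where "\<not> int (m l) dvd coeff a [l]" using ker[OF a] by blast
        then obtain i g where i: "i \<in> word_vars w" and g: "\<forall>x. g x \<in> carrier unit_series"
          and ne: "?W (g(i := a)) w - 1 \<notin> divisible m ?N"
          using detect[OF a] by blast
        \<comment> \<open>With 1 in place \<open>i\<close> the value is 1, so marginality would
          force the value with \<open>a\<close> there to be congruent to 1.\<close>
        let ?g = "g(i := 1)"
        have g1: "\<forall>x. ?g x \<in> carrier unit_series" and ga: "\<forall>x. (g(i := a)) x \<in> carrier unit_series"
          using g a by (simp_all add: coeff_one)
        have "?W ?g w = 1"
          using outer_commutator_one[OF w i group_unit_series g1] by (simp del: fun_upd_apply add: fun_upd_same)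
        moreover have "p (?W (?g(i := ?g i \<otimes>\<^bsub>unit_series\<^esub> a)) w) = p (?W ?g w)"
          using R[unfolded marginal_hom_image[OF p psurj a]] i g1 by blast
        moreover have "?g(i := ?g i \<otimes>\<^bsub>unit_series\<^esub> a) = g(i := a)" by simp
        ultimately have "p (?W (g(i := a)) w) = p 1" by simp
        moreover have "(1 :: 'x series) \<in> carrier unit_series" by (simp add: coeff_one)
        ultimately have "?W (g(i := a)) w - 1 \<in> divisible m ?N"
          using peq[OF word_value_closed[OF group_unit_series ga]] by blast
        with ne show False by blast
      qed
    qed
  qed
qed

section \<open>Test commutators\<close>

definition letter :: "'x \<Rightarrow> 'x series" where
  "letter l = Series (\<lambda>z. if z = [l] then 1 else 0)"

lemma coeff_letter [simp]: "coeff (letter l) z = (if z = [l] then 1 else 0)"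
  by (simp add: letter_def)

lemma letter_vanishing: "letter l \<in> vanishing 1"
  unfolding vanishing_1_iff by simp

lemma one_plus_letter_unit: "1 + letter l \<in> carrier unit_series"
  by (simp add: coeff_one)

lemma coeff_letter_mult: "coeff (letter l * u) (x # z) = (if x = l then coeff u z else 0)"
proof -
  have "(\<lambda>y. coeff (letter l) (x # y)) = (\<lambda>y. (if x = l then 1 else 0) * (if y = [] then 1 else 0))"
    by auto
  then show ?thesis
    by (simp only: times_series_def series.sel conv_Cons conv_scale_left conv_one_left) simp
qed

lemma coeff_mult_letter: "coeff (u * letter l) (z @ [x]) = (if x = l then coeff u z else 0)"
proof -
  have "conv v (coeff (letter l)) (z @ [x]) = (if x = l then v z else 0)" for v
    by (induction z arbitrary: v) (simp_all add: conv_Cons)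
  then show ?thesis by (simp only: times_series_def series.sel)
qed

text \<open>The left-normed Lie commutator \<open>[p, y, ..., y]\<close> with \<open>k\<close>
  entries \<open>y\<close>.\<close>

primrec ad_power :: "'x series \<Rightarrow> 'x series \<Rightarrow> nat \<Rightarrow> 'x series" where
  "ad_power p y 0 = p"
| "ad_power p y (Suc k) = ad_power p y k * y - y * ad_power p y k"

lemma ad_power_vanishing:
  assumes "p \<in> vanishing 1" "y \<in> vanishing 1"
  shows "ad_power p y k \<in> vanishing (k + 1)"
proof (induction k)
  case (Suc k)
  from vanishing_diff vanishing_mult[OF Suc assms(2)] vanishing_mult[OF assms(2) Suc]
  show ?case by auto
qed (use assms in simp)

text \<open>Iterates \<open>commutator_leading_term\<close>; each new entry is exactly
  \<open>1 + y\<close>, so its own error term is 0.\<close>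

lemma left_normed_leading_term:
  assumes g: "\<forall>x. g x \<in> carrier unit_series" and y: "\<And>i. i \<in> {1..c} \<Longrightarrow> g (s + i) = 1 + y"
  shows "word_value unit_series g (left_normed_word s c) - 1 - ad_power (g s - 1) y c \<in> vanishing (c + 2)"
  using y
proof (induction c)
  case 0
  then show ?case by (simp add: vanishing_def)
next
  case (Suc c)
  have s: "g s - 1 \<in> vanishing 1" using spec[OF g] unit_series_vanishing by blast
  have gc: "g (s + Suc c) = 1 + y" using Suc.prems[of "Suc c"] by simp
  have "g (s + Suc c) - 1 \<in> vanishing 1" using spec[OF g] unit_series_vanishing by blast
  then have y1: "y \<in> vanishing 1" using gc by simp
  have "g (s + Suc c) - 1 - y = 0" using gc by simp
  then have y2: "g (s + Suc c) - 1 - y \<in> vanishing (1 + 1)"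
    by (simp only: vanishing_def) simp
  have IH: "word_value unit_series g (left_normed_word s c) - 1 - ad_power (g s - 1) y c
      \<in> vanishing (c + 1 + 1)"
    using Suc by simp
  have W: "word_value unit_series g (left_normed_word s c) \<in> carrier unit_series"
    by (rule word_value_closed[OF group_unit_series g])
  have "word_value unit_series g (comm_word (left_normed_word s c) (Var (s + Suc c))) - 1 -
      (ad_power (g s - 1) y c * y - y * ad_power (g s - 1) y c) \<in> vanishing (c + 1 + 1 + 1)"
    unfolding word_value_comm_word word_value.simps
    by (rule commutator_leading_term(1)[OF W ad_power_vanishing[OF s y1] IH spec[OF g] y1 y2])
  then show ?case by simp
qed

text \<open>In every bracket the product with \<open>letter j\<close> on the left has only words
  beginning with \<open>j\<close>; the other product just appends \<open>j\<close>.\<close>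

lemma coeff_ad_power_letter:
  assumes "i \<noteq> j"
  shows "coeff (ad_power p (letter j) k) (i # replicate k j) = coeff p [i]"
proof (induction k)
  case (Suc k)
  have "i # replicate (Suc k) j = (i # replicate k j) @ [j]" by (simp add: replicate_append_same)
  moreover have "coeff (letter j * ad_power p (letter j) k) (i # replicate (Suc k) j) = 0"
    using assms by (simp only: coeff_letter_mult) simp
  ultimately show ?case
    using Suc coeff_mult_letter[of "ad_power p (letter j) k" j "i # replicate k j" j] by simp
qed simp

text \<open>Both products of the last bracket contribute the same coefficient, and they
  cancel.\<close>

lemma coeff_ad_power_letter_same:
  "coeff (ad_power p (letter j) (Suc k)) (replicate (Suc (Suc k)) j) = 0"
proof -
  let ?X = "ad_power p (letter j) k" and ?z = "replicate (Suc k) j"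
  have "coeff (?X * letter j) (?z @ [j]) = coeff ?X ?z"
    by (simp only: coeff_mult_letter) simp
  moreover have "coeff (letter j * ?X) (j # ?z) = coeff ?X ?z"
    by (simp only: coeff_letter_mult) simp
  moreover have "?z @ [j] = j # ?z" by (simp add: replicate_append_same)
  ultimately show ?thesis by simp
qed

text \<open>Every word in the last bracket begins or ends with \<open>i\<close>.\<close>

lemma coeff_ad_power_letter_other:
  assumes "i \<noteq> j"
  shows "coeff (ad_power p (letter i) (Suc k)) (replicate (Suc n) j) = 0"
proof -
  let ?X = "ad_power p (letter i) k" and ?z = "replicate n j"
  have "coeff (?X * letter i) (?z @ [j]) = 0"
    using assms by (simp only: coeff_mult_letter) simp
  moreover have "coeff (letter i * ?X) (j # ?z) = 0"
    using assms by (simp only: coeff_letter_mult) simp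
  moreover have "?z @ [j] = j # ?z" by (simp add: replicate_append_same)
  ultimately show ?thesis by simp
qed

text \<open>The word ends in \<open>j\<close>, so only the product with \<open>letter i\<close> on
  the left counts, and it asks for a power of \<open>j\<close> in the previous bracket. With
  \<open>c \<ge> 2\<close> that is again a bracket with \<open>letter i\<close>, where this
  coefficient is 0.\<close>

lemma coeff_ad_power_letter_mixed:
  assumes "i \<noteq> j" "c \<ge> 2"
  shows "coeff (ad_power p (letter i) c) (i # replicate c j) = 0"
proof -
  obtain k where c: "c = Suc (Suc k)" using assms(2) by (intro that[of "c - 2"]) simp
  let ?X = "ad_power p (letter i) (Suc k)"
  have "coeff (?X * letter i) ((i # replicate (Suc k) j) @ [j]) = 0"
    using assms(1) by (simp only: coeff_mult_letter) simp
  moreover have "(i # replicate (Suc k) j) @ [j] = i # replicate c j"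
    by (simp add: c replicate_append_same)
  moreover have "coeff (letter i * ?X) (i # replicate c j) = coeff ?X (replicate (Suc (Suc k)) j)"
    by (simp only: coeff_letter_mult c) simp
  ultimately show ?thesis
    using coeff_ad_power_letter_other[OF assms(1), of p k "Suc k"]
    by (simp add: c del: replicate.simps)
qed

text \<open>Since \<open>m l\<close> divides \<open>m j\<close>, it divides the gcd of every word in
  these two letters, so one coefficient not divisible by \<open>m l\<close> suffices.\<close>

lemma not_divisible_if_coeff:
  assumes "P - 1 - Q \<in> vanishing (Suc N)" "length z = N" "set z \<subseteq> {l, j}" "m l dvd m j"
    and "\<not> int (m l) dvd coeff Q z"
  shows "P - 1 \<notin> divisible m N"
proof
  assume "P - 1 \<in> divisible m N"
  moreover have "coeff (P - 1 - Q) z = 0" using assms(1,2) by (simp add: vanishing_def)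
  ultimately have "letter_gcd m z dvd coeff Q z" using assms(2) by (auto simp: divisible_def)
  moreover have "int (m l) dvd letter_gcd m z"
    unfolding letter_gcd_def by (rule Gcd_greatest) (use assms(3,4) in auto)
  ultimately show False using assms(5) dvd_trans by blast
qed

text \<open>With \<open>a\<close> in the first place and \<open>1 + letter j\<close> elsewhere, the
  word \<open>l\<close> followed by \<open>c\<close> letters \<open>j\<close> has the coefficient of
  \<open>l\<close> in \<open>a\<close>.\<close>

lemma nilpotent_word_detects:
  assumes a: "a \<in> carrier unit_series" "\<not> int (m l) dvd coeff a [l]" and j: "j \<noteq> l" "m l dvd m j"
  shows "\<exists>i\<in>word_vars (left_normed_word 0 c). \<exists>g. (\<forall>x. g x \<in> carrier unit_series) \<and>
    word_value unit_series (g(i := a)) (left_normed_word 0 c) - 1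
      \<notin> divisible m (card (word_vars (left_normed_word 0 c)))"
proof (intro bexI exI conjI)
  let ?g = "\<lambda>_ :: nat. 1 + letter j"
  show g: "\<forall>x. ?g x \<in> carrier unit_series" by (intro allI one_plus_letter_unit)
  show "0 \<in> word_vars (left_normed_word 0 c)" by (simp add: word_vars_left_normed_word)
  have g': "\<forall>x. (?g(0 := a)) x \<in> carrier unit_series" using g a by simp
  have lead: "word_value unit_series (?g(0 := a)) (left_normed_word 0 c) - 1 -
      ad_power (a - 1) (letter j) c \<in> vanishing (Suc (Suc c))"
    using left_normed_leading_term[of "?g(0 := a)" c 0 "letter j", OF g'] by simp
  show "word_value unit_series (?g(0 := a)) (left_normed_word 0 c) - 1
      \<notin> divisible m (card (word_vars (left_normed_word 0 c)))"
  proof -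
    have "set (l # replicate c j) \<subseteq> {l, j}" by auto
    then show ?thesis
      unfolding word_vars_left_normed_word
      using not_divisible_if_coeff[where m = m and z = "l # replicate c j", OF lead _ _ j(2)]
        a(2) j(1) coeff_ad_power_letter[of l j "a - 1" c]
      by (simp add: coeff_one del: set_replicate_conv_if)
  qed
qed

text \<open>The leading term is \<open>p q - q p\<close> for two left-normed Lie commutators. A word
  is chosen for which one product gives the coefficient of \<open>l\<close> in \<open>a\<close> and
  the other gives 0.\<close>

lemma outer_commutator_word_detects:
  assumes a: "a \<in> carrier unit_series" "\<not> int (m l) dvd coeff a [l]" and j: "j \<noteq> l" "m l dvd m j"
    and c: "c2 \<ge> 1" "c2 < c1 \<or> c1 = c2 \<and> c2 > 1"
  defines "w \<equiv> comm_word (left_normed_word 0 c1) (left_normed_word (c1 + 1) c2)"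
  shows "\<exists>i\<in>word_vars w. \<exists>g. (\<forall>x. g x \<in> carrier unit_series) \<and>
    word_value unit_series (g(i := a)) w - 1 \<notin> divisible m (card (word_vars w))"
proof -
  have vars: "word_vars w = {0..c1 + 1 + c2}"
    by (auto simp: w_def word_vars_left_normed_word)
  \<comment> \<open>\<open>a\<close> will be put in place 0, so the first half becomes
    \<open>[a, j, ..., j]\<close> and the second half \<open>[r, s, ..., s]\<close> in terms of
    letters.\<close>
  define g where "g r s n = 1 + letter (if n \<le> c1 then j else if n = c1 + 1 then r else s)"
    for r s :: 'a and n :: nat
  have g: "\<forall>x. g r s x \<in> carrier unit_series" for r s
    unfolding g_def by (intro allI one_plus_letter_unit)
  let ?p = "ad_power (a - 1) (letter j) c1" and ?q = "\<lambda>r s. ad_power (letter r) (letter s) c2"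
  have a1: "a - 1 \<in> vanishing 1" using a(1) unit_series_vanishing by blast
  have p: "?p \<in> vanishing (c1 + 1)" using ad_power_vanishing[OF a1 letter_vanishing] .
  have q: "?q r s \<in> vanishing (c2 + 1)" for r s
    using ad_power_vanishing[OF letter_vanishing letter_vanishing] .
  have lead: "word_value unit_series ((g r s)(0 := a)) w - 1 - (?p * ?q r s - ?q r s * ?p)
      \<in> vanishing (Suc (c1 + c2 + 2))" for r s
  proof -
    let ?g = "(g r s)(0 := a)"
    have g': "\<forall>x. ?g x \<in> carrier unit_series" using g a(1) by simp
    have 1: "word_value unit_series ?g (left_normed_word 0 c1) - 1 - ?p \<in> vanishing (c1 + 1 + 1)"
    proof -
      have "?g (0 + i) = 1 + letter j" if "i \<in> {1..c1}" for i using that by (simp add: g_def)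
      from left_normed_leading_term[of ?g c1 0, OF g' this] show ?thesis by simp
    qed
    have 2: "word_value unit_series ?g (left_normed_word (c1 + 1) c2) - 1 - ?q r s
        \<in> vanishing (c2 + 1 + 1)"
    proof -
      have "?g (c1 + 1 + i) = 1 + letter s" if "i \<in> {1..c2}" for i using that by (simp add: g_def)
      from left_normed_leading_term[of ?g c2 "c1 + 1", OF g' this]
      have "word_value unit_series ?g (left_normed_word (c1 + 1) c2) - 1 -
          ad_power (?g (c1 + 1) - 1) (letter s) c2 \<in> vanishing (c2 + 2)" .
      moreover have "?g (c1 + 1) - 1 = letter r" by (simp add: g_def)
      ultimately show ?thesis by simp
    qed
    note closed = word_value_closed[OF group_unit_series g']
    have "word_value unit_series ?g w - 1 - (?p * ?q r s - ?q r s * ?p)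
        \<in> vanishing (c1 + 1 + (c2 + 1) + 1)"
      unfolding w_def word_value_comm_word
      by (rule commutator_leading_term(1)[OF closed p 1 closed q 2])
    then show ?thesis by (simp add: add_ac)
  qed
  have split: "coeff (?p * ?q r s) (x @ y) = coeff ?p x * coeff (?q r s) y"
    if "length x = c1 + 1" "length y = c2 + 1" for r s x y
    using coeff_mult_vanishing[OF p q] that by blast
  have split': "coeff (?q r s * ?p) (x @ y) = coeff (?q r s) x * coeff ?p y"
    if "length x = c2 + 1" "length y = c1 + 1" for r s x y
    using coeff_mult_vanishing[OF q p] that by blast
  have pa: "coeff ?p (l # replicate c1 j) = coeff a [l]"
    using coeff_ad_power_letter[of l j "a - 1" c1] j by (simp add: coeff_one)
  have "\<exists>r s z. length z = c1 + c2 + 2 \<and> set z \<subseteq> {l, j} \<and>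
      \<not> int (m l) dvd coeff (?p * ?q r s - ?q r s * ?p) z"
  proof (cases "c2 < c1")
    case True
    txt \<open>Only one of the two products reaches this word, since every word in \<open>?q l j\<close> contains \<open>l\<close>.\<close>
    let ?z = "(l # replicate c2 j) @ (l # replicate c1 j)"
    let ?x = "l # replicate c2 j @ l # replicate (c1 - c2 - 1) j"
    \<comment> \<open>As \<open>c2 < c1\<close>, the final block of letters \<open>j\<close> has
      length at least \<open>c2 + 1\<close>, so the right part of the cut for
      \<open>?p * ?q l j\<close> consists of \<open>j\<close> alone.\<close>
    have "c1 = (c1 - c2 - 1) + (c2 + 1)" using True by simp
    then have "?z = ?x @ replicate (c2 + 1) j"
      by (metis append.assoc append_Cons replicate_add)
    moreover have "coeff (?q l j) (replicate (c2 + 1) j) = 0"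
      using coeff_ad_power_letter_same[of "letter l" j "c2 - 1"] c(1) by simp
    ultimately have "coeff (?p * ?q l j) ?z = 0"
      using split[of ?x "replicate (c2 + 1) j"] True by simp
    moreover have "coeff (?q l j * ?p) ?z = coeff a [l]"
      using split'[of "l # replicate c2 j" "l # replicate c1 j"] pa
        coeff_ad_power_letter[of l j "letter l" c2] j(1) by simp
    ultimately have "\<not> int (m l) dvd coeff (?p * ?q l j - ?q l j * ?p) ?z"
      using a(2) by simp
    then show ?thesis by (intro exI[of _ l] exI[of _ j] exI[of _ ?z]) auto
  next
    case False
    then have c: "c1 = c2" "c2 \<ge> 2" using c by auto
    \<comment> \<open>For equal weights both products are cut at the same place. The left half
      \<open>l j ... j\<close> has coefficient 0 in \<open>?q j l\<close> because
      \<open>c2 \<ge> 2\<close>, which kills the second product.\<close>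
    let ?z = "(l # replicate c1 j) @ (j # replicate c2 l)"
    have "coeff (?p * ?q j l) ?z = coeff a [l]"
      using split[of "l # replicate c1 j" "j # replicate c2 l"] pa
        coeff_ad_power_letter[of j l "letter j" c2] j(1) by simp
    moreover have "coeff (?q j l * ?p) ?z = 0"
      using split'[of "l # replicate c1 j" "j # replicate c2 l"] c
        coeff_ad_power_letter_mixed[of l j c2 "letter j"] j(1) by simp
    ultimately have "\<not> int (m l) dvd coeff (?p * ?q j l - ?q j l * ?p) ?z"
      using a(2) by simp
    then show ?thesis by (intro exI[of _ j] exI[of _ l] exI[of _ ?z]) auto
  qed
  then obtain r s z where z: "length z = c1 + c2 + 2" "set z \<subseteq> {l, j}"
      "\<not> int (m l) dvd coeff (?p * ?q r s - ?q r s * ?p) z"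
    by blast
  then have "word_value unit_series ((g r s)(0 := a)) w - 1 \<notin> divisible m (c1 + c2 + 2)"
    using not_divisible_if_coeff[where m = m, OF lead _ _ j(2)] by blast
  with g show ?thesis
    unfolding vars by (intro bexI[of _ 0] exI[of _ "g r s"]) simp_all
qed

section \<open>Finitely generated abelian groups\<close>

text \<open>Free coordinates come first with order 0; indices beyond \<open>k + t\<close>, and the
  index 0, get order 1, so that all natural numbers can serve as coordinates and as letters.\<close>

definition coordinate_order :: "nat \<Rightarrow> nat \<Rightarrow> (nat \<Rightarrow> nat) \<Rightarrow> nat \<Rightarrow> nat" where
  "coordinate_order k t n l =
     (if l \<in> {1..k} then 0 else if l \<in> {k + 1..k + t} then n (l - k) else 1)"

lemma finite_coordinate_order: "finite {l. coordinate_order k t n l \<noteq> 1}"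
  by (rule finite_subset[of _ "{..k + t}"]) (auto simp: coordinate_order_def split: if_splits)

text \<open>Describes \<open>G\<close> by arbitrary integer families, with all restriction to index
  sets and reduction of residues hidden in the kernel of \<open>\<sigma>\<close>.\<close>

lemma sum_group_coordinates:
  fixes G :: "('a, 'm) monoid_scheme"
  assumes "group G"
    and "G \<cong> sum_group {1..k} (\<lambda>_. integer_group)
              \<times>\<times> sum_group {1..t} (\<lambda>i. integer_mod_group (n i))" (is "G \<cong> ?H")
  obtains \<sigma> :: "(nat \<Rightarrow> int) \<Rightarrow> 'a"
  where "\<And>f g. \<sigma> (\<lambda>l. f l + g l) = \<sigma> f \<otimes>\<^bsub>G\<^esub> \<sigma> g" "range \<sigma> = carrier G"
    "\<And>f. \<sigma> f = \<one>\<^bsub>G\<^esub> \<longleftrightarrow> (\<forall>l. int (coordinate_order k t n l) dvd f l)"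
proof -
  have H: "group ?H" by (intro DirProd_group sum_group) auto
  have carr: "(x, y) \<in> carrier ?H \<longleftrightarrow> x \<in> extensional {1..k} \<and> y \<in> extensional {1..t} \<and>
      (\<forall>i\<in>{1..t}. y i \<in> carrier (integer_mod_group (n i)))" for x y
    by (auto simp: carrier_sum_group PiE_iff)
  obtain \<phi> where \<phi>: "\<phi> \<in> iso ?H G"
    using group.iso_sym[OF assms(1,2)] unfolding is_iso_def by blast
  define \<tau> :: "(nat \<Rightarrow> int) \<Rightarrow> _" where
    "\<tau> f = (\<lambda>i\<in>{1..k}. f i, \<lambda>i\<in>{1..t}. f (k + i) mod int (n i))" for f
  have \<tau>_carr: "\<tau> f \<in> carrier ?H" for f
    unfolding \<tau>_def carr by (auto simp: carrier_integer_mod_group)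
  have \<tau>_add: "\<tau> (\<lambda>l. f l + g l) = \<tau> f \<otimes>\<^bsub>?H\<^esub> \<tau> g" for f g
    by (auto simp: \<tau>_def fun_eq_iff mod_add_eq)
  have \<tau>_surj: "\<exists>f. \<tau> f = p" if p: "p \<in> carrier ?H" for p
  proof -
    obtain x y where xy: "p = (x, y)" by (cases p)
    define f where "f l = (if l \<le> k then x l else y (l - k))" for l
    have x: "x \<in> extensional {1..k}" and y: "y \<in> extensional {1..t}"
      and yc: "\<And>i. i \<in> {1..t} \<Longrightarrow> y i \<in> carrier (integer_mod_group (n i))"
      using p unfolding xy carr by auto
    have "(\<lambda>i\<in>{1..k}. f i) = x"
      using x by (intro extensionalityI[of _ "{1..k}"]) (auto simp: f_def)
    moreover have "(\<lambda>i\<in>{1..t}. f (k + i) mod int (n i)) = y"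
    proof (rule extensionalityI[of _ "{1..t}"])
      fix i assume i: "i \<in> {1..t}"
      then have "y i mod int (n i) = y i"
        using yc[OF i] by (auto simp: carrier_integer_mod_group split: if_splits)
      with i show "(\<lambda>i\<in>{1..t}. f (k + i) mod int (n i)) i = y i" by (auto simp: f_def)
    qed (use y in auto)
    ultimately have "\<tau> f = p" unfolding \<tau>_def xy by simp
    then show ?thesis by blast
  qed
  have restrict_zero: "(\<lambda>i\<in>A. F i) = (\<lambda>i\<in>A. 0) \<longleftrightarrow> (\<forall>i\<in>A. F i = 0)"
    for A :: "nat set" and F :: "nat \<Rightarrow> int"
    by (auto simp: restrict_def fun_eq_iff)
  have \<tau>_one: "\<tau> f = \<one>\<^bsub>?H\<^esub> \<longleftrightarrow> (\<forall>l. int (coordinate_order k t n l) dvd f l)" for f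
  proof -
    have "\<tau> f = \<one>\<^bsub>?H\<^esub> \<longleftrightarrow> (\<forall>i\<in>{1..k}. f i = 0) \<and> (\<forall>i\<in>{1..t}. int (n i) dvd f (k + i))"
      by (simp add: \<tau>_def restrict_zero dvd_eq_mod_eq_0)
    also have "\<dots> \<longleftrightarrow> (\<forall>l. int (coordinate_order k t n l) dvd f l)" (is "?L \<longleftrightarrow> ?R")
    proof
      assume L: ?L
      show ?R
      proof
        fix l
        have "int (n (l - k)) dvd f l" if "l \<in> {k + 1..k + t}"
        proof -
          have "l - k \<in> {1..t}" "k + (l - k) = l" using that by auto
          with bspec[OF conjunct2[OF L], of "l - k"] show ?thesis by simp
        qed
        then show "int (coordinate_order k t n l) dvd f l"
          using L by (simp add: coordinate_order_def)
      qed
    next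
      assume R: ?R
      show ?L
      proof (intro conjI ballI)
        fix i assume "i \<in> {1..k}"
        then show "f i = 0" using spec[OF R, of i] by (simp add: coordinate_order_def)
      next
        fix i assume "i \<in> {1..t}"
        then show "int (n i) dvd f (k + i)"
          using spec[OF R, of "k + i"] by (simp add: coordinate_order_def)
      qed
    qed
    finally show ?thesis .
  qed
  have \<phi>hom: "\<phi> \<in> hom ?H G" and \<phi>bij: "bij_betw \<phi> (carrier ?H) (carrier G)"
    using \<phi> by (auto simp: iso_def)
  have "\<phi> (\<tau> (\<lambda>l. f l + g l)) = \<phi> (\<tau> f) \<otimes>\<^bsub>G\<^esub> \<phi> (\<tau> g)" for f g
    unfolding \<tau>_add by (rule hom_mult[OF \<phi>hom \<tau>_carr \<tau>_carr])
  moreover have "range (\<lambda>f. \<phi> (\<tau> f)) = carrier G"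
  proof -
    have "range \<tau> = carrier ?H"
    proof (intro subset_antisym subsetI)
      fix p assume "p \<in> carrier ?H"
      from \<tau>_surj[OF this] obtain f where "\<tau> f = p" ..
      then show "p \<in> range \<tau>" by blast
    qed (use \<tau>_carr in blast)
    then have "\<phi> ` range \<tau> = carrier G" using \<phi>bij by (simp add: bij_betw_def)
    then show ?thesis by (simp only: image_image)
  qed
  moreover have "\<phi> (\<tau> f) = \<one>\<^bsub>G\<^esub> \<longleftrightarrow> (\<forall>l. int (coordinate_order k t n l) dvd f l)" for f
  proof -
    have "\<phi> \<one>\<^bsub>?H\<^esub> = \<one>\<^bsub>G\<^esub>" by (rule hom_one[OF \<phi>hom H assms(1)])
    moreover have "\<one>\<^bsub>?H\<^esub> \<in> carrier ?H" by (rule monoid.one_closed[OF group.is_monoid[OF H]])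
    ultimately have "\<phi> (\<tau> f) = \<one>\<^bsub>G\<^esub> \<longleftrightarrow> \<tau> f = \<one>\<^bsub>?H\<^esub>"
      using inj_on_eq_iff[OF bij_betw_imp_inj_on[OF \<phi>bij] \<tau>_carr] by metis
    then show ?thesis unfolding \<tau>_one .
  qed
  ultimately show ?thesis by (rule that)
qed

text \<open>The \<open>l\<close>-th coordinate has order \<open>m l\<close>, where \<open>0\<close> means infinite order.\<close>

locale coordinates = comm_group G for G :: "('a, 'b) monoid_scheme" (structure) +
  fixes \<sigma> :: "('x \<Rightarrow> int) \<Rightarrow> 'a" and m :: "'x \<Rightarrow> nat"
  assumes additive: "\<sigma> (\<lambda>l. f l + g l) = \<sigma> f \<otimes> \<sigma> g"
    and surj: "range \<sigma> = carrier G"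
    and kernel_iff: "\<sigma> f = \<one> \<longleftrightarrow> (\<forall>l. int (m l) dvd f l)"
begin

lemma closed [simp]: "\<sigma> f \<in> carrier G"
  using surj by blast

lemma eq_if_congruent:
  assumes "\<And>l. int (m l) dvd f l - g l"
  shows "\<sigma> f = \<sigma> g"
proof -
  have "\<sigma> f = \<sigma> (\<lambda>l. (f l - g l) + g l)" by simp
  also have "\<dots> = \<sigma> (\<lambda>l. f l - g l) \<otimes> \<sigma> g" by (rule additive)
  also have "\<sigma> (\<lambda>l. f l - g l) = \<one>" using assms kernel_iff by simp
  finally show ?thesis by simp
qed

lemma sigma_nat_pow: "\<sigma> f [^] N = \<sigma> (\<lambda>l. int N * f l)"
proof (induction N)
  case 0
  show ?case using kernel_iff[of "\<lambda>_. 0"] by simp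
next
  case (Suc N)
  have "\<sigma> (\<lambda>l. int (Suc N) * f l) = \<sigma> (\<lambda>l. int N * f l + f l)" by (simp add: algebra_simps)
  also have "\<dots> = \<sigma> (\<lambda>l. int N * f l) \<otimes> \<sigma> f" by (rule additive)
  finally show ?case using Suc by simp
qed

lemma sigma_inv: "inv (\<sigma> f) = \<sigma> (\<lambda>l. - f l)"
proof (rule inv_equality)
  have "\<sigma> (\<lambda>l. - f l) \<otimes> \<sigma> f = \<sigma> (\<lambda>l. - f l + f l)" by (rule additive[symmetric])
  then show "\<sigma> (\<lambda>l. - f l) \<otimes> \<sigma> f = \<one>" using kernel_iff by simp
qed simp_all

lemma sigma_int_pow: "\<sigma> f [^] (i :: int) = \<sigma> (\<lambda>l. i * f l)"
proof (cases i rule: int_cases2)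
  case (nonneg N)
  then show ?thesis by (simp add: int_pow_int sigma_nat_pow)
next
  case (nonpos N)
  then show ?thesis by (simp add: int_pow_neg int_pow_int sigma_nat_pow sigma_inv)
qed

text \<open>If \<open>N\<close> annihilates all coordinates except \<open>l0\<close>, the
  \<open>N\<close>-th powers are generated by that of the unit vector at \<open>l0\<close>;
  capability forces this power to be trivial.\<close>

lemma capable_imp:
  assumes vc: "varietal_capable TYPE('e) {w} G" and w: "outer_commutator w" "\<nexists>y. w = Var y"
    and N: "\<And>l. l \<noteq> l0 \<Longrightarrow> m l dvd N"
  shows "m l0 dvd N"
proof (rule ccontr)
  assume ne: "\<not> m l0 dvd N"
  define \<delta> :: "'x \<Rightarrow> int" where "\<delta> l = (if l = l0 then 1 else 0)" for l
  have "\<not> varietal_capable TYPE('e) {w} G"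
  proof (rule not_varietal_capable[OF comm_group_axioms w, of "\<sigma> \<delta>" N])
    show "\<sigma> \<delta> [^] N \<noteq> \<one>"
      unfolding sigma_nat_pow kernel_iff using ne by (auto intro!: exI[of _ l0] simp: \<delta>_def)
    fix g assume "g \<in> carrier G"
    then obtain f where f: "g = \<sigma> f" using surj by blast
    have "int (m l) dvd int N * f l - f l0 * (int N * \<delta> l)" for l
      using N[of l] by (cases "l = l0") (simp_all add: \<delta>_def)
    then have "g [^] N = (\<sigma> \<delta> [^] N) [^] f l0"
      unfolding f sigma_nat_pow sigma_int_pow by (rule eq_if_congruent)
    then show "\<exists>i :: int. g [^] N = (\<sigma> \<delta> [^] N) [^] i" ..
  qed simp
  with vc show False by blast
qed

text \<open>The linear coefficients add under multiplication of series with constant term 1, so they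
  define a homomorphism onto \<open>G\<close>.\<close>

lemma capable_if:
  assumes w: "outer_commutator w" and fin: "finite {l. m l \<noteq> 1}" and inf: "infinite (UNIV :: 'e set)"
    and detect: "\<And>a l. a \<in> carrier unit_series \<Longrightarrow> \<not> int (m l) dvd coeff a [l] \<Longrightarrow>
      \<exists>i\<in>word_vars w. \<exists>g. (\<forall>x. g x \<in> carrier unit_series) \<and>
        word_value unit_series (g(i := a)) w - 1 \<notin> divisible m (card (word_vars w))"
  shows "varietal_capable TYPE('e) {w} G"
proof -
  define \<psi> where "\<psi> u = \<sigma> (\<lambda>l. coeff u [l])" for u
  have "\<psi> (u * v) = \<psi> u \<otimes> \<psi> v" if "coeff u [] = 1" "coeff v [] = 1" for u v
  proof -
    have "\<psi> (u * v) = \<sigma> (\<lambda>l. coeff u [l] + coeff v [l])"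
      unfolding \<psi>_def using that by (simp add: coeff_mult_single add.commute)
    then show ?thesis unfolding \<psi>_def additive .
  qed
  then have hom: "group_hom unit_series G \<psi>"
    unfolding group_hom_def group_hom_axioms_def
    using group_unit_series is_group by (auto simp: \<psi>_def intro!: homI)
  have "x \<in> \<psi> ` carrier unit_series" if x: "x \<in> carrier G" for x
  proof -
    obtain f where f: "x = \<sigma> f" using x surj by blast
    \<comment> \<open>Only the constant and linear coefficients matter; those of longer words are
      arbitrary.\<close>
    define u where "u = Series (\<lambda>z. case z of [] \<Rightarrow> 1 | l # _ \<Rightarrow> f l)"
    have "u \<in> carrier unit_series" "\<psi> u = x" by (simp_all add: u_def \<psi>_def f)
    then show ?thesis by blast
  qed
  then have "\<psi> ` carrier unit_series = carrier G" by (auto simp: \<psi>_def)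
  from varietal_capable_if_detected[OF w hom this _ fin inf detect]
  show ?thesis by (simp add: \<psi>_def kernel_iff)
qed

end

text \<open>\<open>nontrivial\<close> excludes the trivial group, which is capable but for
  \<open>k = 0\<close> and \<open>t = 0\<close> violates (v).\<close>

locale fg_abelian = comm_group G for G :: "('a, 'b) monoid_scheme" (structure) +
  fixes k t :: nat and n :: "nat \<Rightarrow> nat"
  assumes presentation: "G \<cong> sum_group {1..k} (\<lambda>_. integer_group)
              \<times>\<times> sum_group {1..t} (\<lambda>i. integer_mod_group (n i))"
    and pos: "\<And>i. i \<in> {1..t} \<Longrightarrow> n i \<ge> 1"
    and chain: "\<And>i. i \<in> {1..<t} \<Longrightarrow> n (i + 1) dvd n i"
    and nontrivial: "carrier G \<noteq> {\<one>}"
begin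

abbreviation m where "m \<equiv> coordinate_order k t n"

lemma coordinates_ex: "\<exists>\<sigma>. coordinates G \<sigma> m"
proof -
  obtain \<sigma> :: "(nat \<Rightarrow> int) \<Rightarrow> 'a"
    where "\<And>f g. \<sigma> (\<lambda>l. f l + g l) = \<sigma> f \<otimes> \<sigma> g" "range \<sigma> = carrier G"
      "\<And>f. \<sigma> f = \<one> \<longleftrightarrow> (\<forall>l. int (m l) dvd f l)"
    using sum_group_coordinates[OF is_group presentation] by blast
  then have "coordinates G \<sigma> m" by unfold_locales
  then show ?thesis by blast
qed

lemma dvd_first: "i \<in> {1..t} \<Longrightarrow> n i dvd n 1"
proof (induction i)
  case (Suc i)
  show ?case
  proof (cases "i = 0")
    case False
    then have "n (i + 1) dvd n i" "n i dvd n 1" using Suc chain by auto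
    then show ?thesis using dvd_trans by simp
  qed simp
qed simp

lemma capable_imp_orders:
  assumes "varietal_capable TYPE('e) {w} G" "outer_commutator w" "\<nexists>y. w = Var y"
  shows "k \<ge> 2 \<or> k = 0 \<and> t \<ge> 2 \<and> n 1 = n 2"
proof -
  obtain \<sigma> where "coordinates G \<sigma> m" using coordinates_ex by blast
  then interpret coordinates G \<sigma> m .
  note imp = capable_imp[OF assms]
  have m_le: "l \<in> {k + 1..k + t} \<or> m l = 1" if "k = 1" "l \<noteq> 1" for l
    using that by (auto simp: coordinate_order_def)
  have m_gt: "m l = n (l - k)" if "l \<in> {k + 1..k + t}" for l
    using that by (auto simp: coordinate_order_def)
  consider "k \<ge> 2" | "k = 1" | "k = 0" by linarith
  then show ?thesis
  proof cases
    case k: 2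
    \<comment> \<open>The exponent of the torsion part. It is annihilating outside the only free
      coordinate, whose order 0 would have to divide it.\<close>
    define N where "N = (if t = 0 then 1 else n 1)"
    have "m l dvd N" if "l \<noteq> 1" for l
    proof (cases "l \<in> {k + 1..k + t}")
      case True
      then have "l - k \<in> {1..t}" by auto
      then show ?thesis using m_gt[OF True] dvd_first by (auto simp: N_def)
    next
      case False
      then have "m l = 1" using m_le[of l] that k by blast
      then show ?thesis by simp
    qed
    then have "m 1 dvd N" by (rule imp)
    then have "N = 0" using k by (simp add: coordinate_order_def)
    then show ?thesis using pos[of 1] by (auto simp: N_def split: if_splits)
  next
    case k: 3
    have ml: "m l = (if l \<in> {1..t} then n l else 1)" for l
      using k by (simp add: coordinate_order_def)
    \<comment> \<open>Nontriviality gives some factor of order different from 1, hence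
      \<open>n 1 \<noteq> 1\<close>; this will rule out \<open>t = 1\<close>.\<close>
    obtain x where "x \<in> carrier G" "x \<noteq> \<one>" using nontrivial one_closed by blast
    then obtain f where "\<sigma> f \<noteq> \<one>" using surj by (metis imageE)
    then obtain l where "\<not> int (m l) dvd f l" using kernel_iff by blast
    then have l: "l \<in> {1..t}" "n l \<noteq> 1" by (auto simp: ml split: if_splits)
    then have n1: "n 1 \<noteq> 1" using dvd_first[OF l(1)] by auto
    \<comment> \<open>The exponent of all coordinates but the first, by the divisibility
      chain.\<close>
    define N where "N = (if t \<ge> 2 then n 2 else 1)"
    have dvd2: "n i dvd n 2" if "i \<in> {2..t}" for i
      using that
    proof (induction i)
      case (Suc i)
      show ?case
      proof (cases "i = 1")
        case False
        then have "n (i + 1) dvd n i" "n i dvd n 2" using Suc chain by auto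
        then show ?thesis using dvd_trans by simp
      qed (simp add: numeral_2_eq_2)
    qed simp
    have "m l dvd N" if "l \<noteq> 1" for l
      using that dvd2[of l] by (auto simp: ml N_def)
    then have "m 1 dvd N" by (rule imp)
    then have n1N: "n 1 dvd N" using l by (simp add: ml)
    with n1 have t: "t \<ge> 2" by (auto simp: N_def split: if_splits)
    then have "n 2 dvd n 1" by (intro dvd_first) simp
    with n1N t have "n 1 = n 2" by (simp add: N_def dvd_antisym)
    with k t show ?thesis by simp
  qed simp
qed

text \<open>For \<open>k \<ge> 2\<close> another free coordinate serves, since every order divides
  0. For \<open>k = 0\<close> the first coordinate serves all others, and the second serves the
  first.\<close>

lemma partner_ex:
  assumes "k \<ge> 2 \<or> k = 0 \<and> t \<ge> 2 \<and> n 1 = n 2" "m l \<noteq> 1"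
  shows "\<exists>j. j \<noteq> l \<and> m l dvd m j"
proof (cases "k \<ge> 2")
  case True
  then have "m 1 = 0" "m 2 = 0" by (simp_all add: coordinate_order_def)
  then show ?thesis by (intro exI[of _ "if l = 1 then 2 else 1"]) simp
next
  case False
  then have k: "k = 0" and t: "t \<ge> 2" "n 1 = n 2" using assms by auto
  have ml: "m l = (if l \<in> {1..t} then n l else 1)" for l
    using k by (simp add: coordinate_order_def)
  have l: "l \<in> {1..t}" using assms(2) by (auto simp: ml split: if_splits)
  show ?thesis
  proof (cases "l = 1")
    case True
    then show ?thesis using t by (intro exI[of _ 2]) (simp add: ml)
  next
    case False
    then show ?thesis using l t dvd_first[OF l] by (intro exI[of _ 1]) (simp add: ml)
  qed
qed

lemma nilpotent_capable:
  assumes "k \<ge> 2 \<or> k = 0 \<and> t \<ge> 2 \<and> n 1 = n 2" "infinite (UNIV :: 'e set)"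
  shows "varietal_capable TYPE('e) (nilpotent_words c) G"
proof -
  obtain \<sigma> where "coordinates G \<sigma> m" using coordinates_ex by blast
  then interpret coordinates G \<sigma> m .
  show ?thesis
    unfolding nilpotent_words_def
  proof (rule capable_if[OF outer_commutator_left_normed finite_coordinate_order assms(2)])
    fix a :: "nat series" and l
    assume a: "a \<in> carrier unit_series" "\<not> int (m l) dvd coeff a [l]"
    then have "m l \<noteq> 1" by auto
    then obtain j where "j \<noteq> l" "m l dvd m j" using partner_ex[OF assms(1)] by blast
    with a show "\<exists>i\<in>word_vars (left_normed_word 0 c). \<exists>g. (\<forall>x. g x \<in> carrier unit_series) \<and>
        word_value unit_series (g(i := a)) (left_normed_word 0 c) - 1
          \<notin> divisible m (card (word_vars (left_normed_word 0 c)))"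
      by (rule nilpotent_word_detects)
  qed
qed

lemma outer_commutator_words_outer:
  "outer_commutator (comm_word (left_normed_word 0 c1) (left_normed_word (c1 + 1) c2))"
  by (intro outer_commutator.comm outer_commutator_left_normed)
     (auto simp: word_vars_left_normed_word)

lemma outer_commutator_capable:
  assumes "k \<ge> 2 \<or> k = 0 \<and> t \<ge> 2 \<and> n 1 = n 2" "infinite (UNIV :: 'e set)"
    and c: "c2 \<ge> 1" "c2 < c1 \<or> c1 = c2 \<and> c2 > 1"
  shows "varietal_capable TYPE('e) (outer_commutator_words c1 c2) G"
proof -
  obtain \<sigma> where "coordinates G \<sigma> m" using coordinates_ex by blast
  then interpret coordinates G \<sigma> m .
  show ?thesis
    unfolding outer_commutator_words_def
  proof (rule capable_if[OF outer_commutator_words_outer finite_coordinate_order assms(2)])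
    fix a :: "nat series" and l
    assume a: "a \<in> carrier unit_series" "\<not> int (m l) dvd coeff a [l]"
    then have "m l \<noteq> 1" by auto
    then obtain j where "j \<noteq> l" "m l dvd m j" using partner_ex[OF assms(1)] by blast
    from outer_commutator_word_detects[OF a this c]
    show "\<exists>i\<in>word_vars (comm_word (left_normed_word 0 c1) (left_normed_word (c1 + 1) c2)).
        \<exists>g. (\<forall>x. g x \<in> carrier unit_series) \<and>
        word_value unit_series (g(i := a)) (comm_word (left_normed_word 0 c1) (left_normed_word (c1 + 1) c2)) - 1
          \<notin> divisible m (card (word_vars (comm_word (left_normed_word 0 c1) (left_normed_word (c1 + 1) c2))))" .
  qed
qed

lemma nilpotent_capable_imp:
  assumes "varietal_capable TYPE('e) (nilpotent_words c) G" "c \<ge> 1"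
  shows "k \<ge> 2 \<or> k = 0 \<and> t \<ge> 2 \<and> n 1 = n 2"
proof -
  obtain c' where "c = Suc c'" using assms(2) by (cases c) auto
  then have "\<nexists>y. left_normed_word 0 c = Var y" by simp
  from capable_imp_orders[OF assms(1)[unfolded nilpotent_words_def] outer_commutator_left_normed this]
  show ?thesis .
qed

lemma outer_commutator_capable_imp:
  assumes "varietal_capable TYPE('e) (outer_commutator_words c1 c2) G"
  shows "k \<ge> 2 \<or> k = 0 \<and> t \<ge> 2 \<and> n 1 = n 2"
  using capable_imp_orders[OF assms[unfolded outer_commutator_words_def] outer_commutator_words_outer]
  by simp

end

text \<open>Each of (i) to (iv) is shown equivalent to (v) separately, which allows an independent
  parameter type for each.\<close>

theorem theorem4p4:
  fixes G :: "('a, 'm) monoid_scheme"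
    and k t :: nat
    and n :: "nat \<Rightarrow> nat"
  assumes "comm_group G"
    and "G \<cong> sum_group {1..k} (\<lambda>_. integer_group)
              \<times>\<times> sum_group {1..t} (\<lambda>i. integer_mod_group (n i))"
    and "\<And>i. i \<in> {1..t} \<Longrightarrow> n i \<ge> 1"
    and "\<And>i. i \<in> {1..<t} \<Longrightarrow> n (i + 1) dvd n i"
    and "carrier G \<noteq> {\<one>\<^bsub>G\<^esub>}"
    and "infinite (UNIV :: 'e1 set)"
    and "infinite (UNIV :: 'e2 set)"
    and "infinite (UNIV :: 'e3 set)"
    and "infinite (UNIV :: 'e4 set)"
  shows "(capable TYPE('e1) G \<longleftrightarrow>
            (\<exists>c::nat. c \<ge> 1 \<and> varietal_capable TYPE('e2) (nilpotent_words c) G))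
       \<and> ((\<exists>c::nat. c \<ge> 1 \<and> varietal_capable TYPE('e2) (nilpotent_words c) G) \<longleftrightarrow>
            (\<forall>c::nat. c \<ge> 1 \<longrightarrow> varietal_capable TYPE('e3) (nilpotent_words c) G))
       \<and> ((\<forall>c::nat. c \<ge> 1 \<longrightarrow> varietal_capable TYPE('e3) (nilpotent_words c) G) \<longleftrightarrow>
            (\<forall>c1 c2::nat. c1 \<ge> 1 \<and> c2 \<ge> 1 \<and> (c2 < c1 \<and> c1 \<le> 2 * c2 \<or> c1 = c2 \<and> c2 > 1) \<longrightarrow>
               varietal_capable TYPE('e4) (outer_commutator_words c1 c2) G))
       \<and> ((\<forall>c1 c2::nat. c1 \<ge> 1 \<and> c2 \<ge> 1 \<and> (c2 < c1 \<and> c1 \<le> 2 * c2 \<or> c1 = c2 \<and> c2 > 1) \<longrightarrow>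
               varietal_capable TYPE('e4) (outer_commutator_words c1 c2) G) \<longleftrightarrow>
            k \<ge> 2 \<or> (k = 0 \<and> t \<ge> 2 \<and> n 1 = n 2))"
proof -
  interpret comm_group G by fact
  interpret fg_abelian G k t n
    using assms(2-5) by unfold_locales
  let ?P = "k \<ge> 2 \<or> k = 0 \<and> t \<ge> 2 \<and> n 1 = n 2"
  have i: "capable TYPE('e1) G \<longleftrightarrow> ?P"
    unfolding capable_iff_nilpotent
    using nilpotent_capable_imp[where 'e = 'e1 and c = 1] nilpotent_capable[where 'e = 'e1] assms(6)
    by blast
  have ii: "(\<exists>c::nat. c \<ge> 1 \<and> varietal_capable TYPE('e2) (nilpotent_words c) G) \<longleftrightarrow> ?P"
    using nilpotent_capable_imp[where 'e = 'e2] nilpotent_capable[where 'e = 'e2] assms(7)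
    by blast
  have iii: "(\<forall>c::nat. c \<ge> 1 \<longrightarrow> varietal_capable TYPE('e3) (nilpotent_words c) G) \<longleftrightarrow> ?P"
    using nilpotent_capable_imp[where 'e = 'e3] nilpotent_capable[where 'e = 'e3] assms(8)
    by blast
  have iv: "(\<forall>c1 c2::nat. c1 \<ge> 1 \<and> c2 \<ge> 1 \<and> (c2 < c1 \<and> c1 \<le> 2 * c2 \<or> c1 = c2 \<and> c2 > 1) \<longrightarrow>
      varietal_capable TYPE('e4) (outer_commutator_words c1 c2) G) \<longleftrightarrow> ?P" (is "?C \<longleftrightarrow> _")
  proof
    assume ?C
    \<comment> \<open>The pair (2, 2) is an admissible instance of (iv), and one instance already
      implies (v).\<close>
    then have "varietal_capable TYPE('e4) (outer_commutator_words 2 2) G" by simp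
    then show ?P by (rule outer_commutator_capable_imp)
  next
    assume ?P
    then show ?C using outer_commutator_capable[where 'e = 'e4] assms(9) by blast
  qed
  show ?thesis unfolding i ii iii iv by blast
qed

end
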